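(* Let $P$ be a finite $(3+1)$-free poset and $\lambda$ a partition with $\lambda_1\le 2$. Then $$\mathfrak{m}^P_\lambda(\mathbf{u})\equiv\sum_{T\in\mathrm{LT}_P(\lambda)}\mathbf{u}_{\mathrm{colword}(T)}\pmod{I^P_H}.$$
   Context: $a<_Pb$: strict order; $a\sim_Pb$: incomparable or equal. $\mathcal{U}_P=\mathbb{Z}\langle u_a:a\in P\rangle$. $e^P_k(\mathbf{u})=\sum u_{a_1}\cdots u_{a_k}$ over $a_1>_P\cdots>_Pa_k$ ($e^P_0=1$, $e^P_k=0$ for $k<0$). $\mathfrak{J}^P_\mu(\mathbf{u})=\sum_{\pi\in S_j}\mathrm{sgn}(\pi)\prod_{i=1}^je^P_{\mu'_i+\pi(i)-i}(\mathbf{u})$ with $j=\mu_1$; $\mathfrak{m}^P_\lambda=\sum_\mu(K^{-1})_{\lambda\mu}\mathfrak{J}^P_\mu$ with $K$ the Kostka matrix. $I^P_H$: two-sided ideal generated by $u_cu_a-u_au_c$ ($a<_Pc$) and $u_cu_au_b-u_bu_cu_a$ ($a\sim_Pb$, $b\sim_Pc$, $a<_Pc$). $P$-tableau: filling of a Young diagram with $T(1,c)<_PT(2,c)<_P\cdots$ down columns and $T(r,c+1)\not<_PT(r,c)$ along rows; colword reads columns bottom to top, left to right. For chains $C,D$ of $P$, $\mathrm{inc}_P(C,D)$ is the bipartite graph with parts $C$ and $D$ (taken disjointly) and an edge $c$—$d$ whenever $c\sim_Pd$; a ladder of $(C,D)$ is (the vertex set of) a connected component. A ladder $L$ is balanced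 if $|L\cap C|=|L\cap D|$ and left unbalanced if $|L\cap C|>|L\cap D|$. For a $P$-tableau $T$ with at most two columns $T_1,T_2$ (viewed as chains; $T_2$ possibly empty), its ladders are those of $(T_1,T_2)$; $T$ is a left $P$-tableau if each of its ladders is balanced or left unbalanced. $\mathrm{LT}_P(\lambda)$ is the set of left $P$-tableaux of shape $\lambda$. *)

theory Defs
  imports Main "HOL-Combinatorics.Permutations"
begin

text \<open>A finite poset P is a finite type 'a with a strict partial order lt (a <_P b).\<close>

definition strict_poset :: "('a \<Rightarrow> 'a \<Rightarrow> bool) \<Rightarrow> bool" where
  "strict_poset lt \<longleftrightarrow> (\<forall>x. \<not> lt x x) \<and> (\<forall>x y z. lt x y \<longrightarrow> lt y z \<longrightarrow> lt x z)"

definition sim :: "('a \<Rightarrow> 'a \<Rightarrow> bool) \<Rightarrow> 'a \<Rightarrow> 'a \<Rightarrow> bool" where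
  "sim lt a b \<longleftrightarrow> \<not> lt a b \<and> \<not> lt b a"

definition free_3_1 :: "('a \<Rightarrow> 'a \<Rightarrow> bool) \<Rightarrow> bool" where
  "free_3_1 lt \<longleftrightarrow> \<not> (\<exists>a b c d. lt a b \<and> lt b c \<and> sim lt d a \<and> sim lt d b \<and> sim lt d c)"

text \<open>An element of Z<u_a> is represented by its coefficient function on words (monomials);
  the word [a1,...,ak] stands for u_a1 ... u_ak.  Genuine polynomials are finitely supported.\<close>

type_synonym 'a ncpoly = "'a list \<Rightarrow> int"

definition ncpoly_fin :: "'a ncpoly \<Rightarrow> bool" where
  "ncpoly_fin f \<longleftrightarrow> finite {w. f w \<noteq> 0}"

definition mono :: "'a list \<Rightarrow> 'a ncpoly" where
  "mono w = (\<lambda>v. if v = w then 1 else 0)"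

definition ncadd :: "'a ncpoly \<Rightarrow> 'a ncpoly \<Rightarrow> 'a ncpoly" where
  "ncadd f g = (\<lambda>w. f w + g w)"

definition ncsub :: "'a ncpoly \<Rightarrow> 'a ncpoly \<Rightarrow> 'a ncpoly" where
  "ncsub f g = (\<lambda>w. f w - g w)"

definition ncmul :: "'a ncpoly \<Rightarrow> 'a ncpoly \<Rightarrow> 'a ncpoly" where
  "ncmul f g = (\<lambda>w. \<Sum>i\<le>length w. f (take i w) * g (drop i w))"

definition ncprod :: "'a ncpoly list \<Rightarrow> 'a ncpoly" where
  "ncprod fs = foldr ncmul fs (mono [])"

inductive_set ideal_H :: "('a \<Rightarrow> 'a \<Rightarrow> bool) \<Rightarrow> 'a ncpoly set" for lt where
  gen1: "lt a c \<Longrightarrow> ncsub (mono [c, a]) (mono [a, c]) \<in> ideal_H lt"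
| gen2: "sim lt a b \<Longrightarrow> sim lt b c \<Longrightarrow> lt a c \<Longrightarrow>
           ncsub (mono [c, a, b]) (mono [b, c, a]) \<in> ideal_H lt"
| zero: "(\<lambda>_. 0) \<in> ideal_H lt"
| add: "f \<in> ideal_H lt \<Longrightarrow> g \<in> ideal_H lt \<Longrightarrow> ncadd f g \<in> ideal_H lt"
| lmul: "f \<in> ideal_H lt \<Longrightarrow> ncpoly_fin p \<Longrightarrow> ncmul p f \<in> ideal_H lt"
| rmul: "f \<in> ideal_H lt \<Longrightarrow> ncpoly_fin p \<Longrightarrow> ncmul f p \<in> ideal_H lt"

definition congH :: "('a \<Rightarrow> 'a \<Rightarrow> bool) \<Rightarrow> 'a ncpoly \<Rightarrow> 'a ncpoly \<Rightarrow> bool" where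
  "congH lt f g \<longleftrightarrow> ncsub f g \<in> ideal_H lt"

text \<open>e^P_k = sum of u_a1 ... u_ak over a1 >_P ... >_P ak (coefficientwise: each such word
  has coefficient 1); e^P_0 = 1 and e^P_k = 0 for k < 0.\<close>
definition eP :: "('a \<Rightarrow> 'a \<Rightarrow> bool) \<Rightarrow> int \<Rightarrow> 'a ncpoly" where
  "eP lt k = (\<lambda>w. if k \<ge> 0 \<and> int (length w) = k \<and> sorted_wrt (\<lambda>x y. lt y x) w then 1 else 0)"

definition is_partition :: "nat list \<Rightarrow> bool" where
  "is_partition \<mu> \<longleftrightarrow> sorted_wrt (\<ge>) \<mu> \<and> (\<forall>p\<in>set \<mu>. 0 < p)"

definition partitions :: "nat \<Rightarrow> nat list set" where
  "partitions n = {\<mu>. is_partition \<mu> \<and> sum_list \<mu> = n}"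

definition part1 :: "nat list \<Rightarrow> nat" where
  "part1 \<mu> = (if \<mu> = [] then 0 else hd \<mu>)"

definition conj_part :: "nat list \<Rightarrow> nat \<Rightarrow> nat" where
  "conj_part \<mu> i = length (filter (\<lambda>p. i \<le> p) \<mu>)"

definition cells :: "nat list \<Rightarrow> (nat \<times> nat) set" where
  "cells la = {(r, c). r < length la \<and> c < la ! r}"

definition ssyt :: "nat list \<Rightarrow> nat list \<Rightarrow> (nat \<times> nat \<Rightarrow> nat) set" where
  "ssyt la \<mu> = {T. (\<forall>x. x \<notin> cells la \<longrightarrow> T x = 0)
     \<and> (\<forall>x\<in>cells la. 1 \<le> T x \<and> T x \<le> length \<mu>)
     \<and> (\<forall>r c. (r, Suc c) \<in> cells la \<longrightarrow> T (r, c) \<le> T (r, Suc c))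
     \<and> (\<forall>r c. (Suc r, c) \<in> cells la \<longrightarrow> T (r, c) < T (Suc r, c))
     \<and> (\<forall>i\<in>{1..length \<mu>}. card {x\<in>cells la. T x = i} = \<mu> ! (i - 1))}"

definition kostka :: "nat list \<Rightarrow> nat list \<Rightarrow> int" where
  "kostka la \<mu> = int (card (ssyt la \<mu>))"

definition kostka_inv :: "nat \<Rightarrow> nat list \<Rightarrow> nat list \<Rightarrow> int" where
  "kostka_inv n = (THE M. (\<forall>la \<mu>. M la \<mu> \<noteq> 0 \<longrightarrow> la \<in> partitions n \<and> \<mu> \<in> partitions n)
      \<and> (\<forall>la\<in>partitions n. \<forall>\<mu>\<in>partitions n.
           (\<Sum>\<nu>\<in>partitions n. M la \<nu> * kostka \<nu> \<mu>) = (if la = \<mu> then 1 else 0)))"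

definition JP :: "('a \<Rightarrow> 'a \<Rightarrow> bool) \<Rightarrow> nat list \<Rightarrow> 'a ncpoly" where
  "JP lt \<mu> = (\<lambda>w. \<Sum>\<pi>\<in>{\<pi>. \<pi> permutes {1..part1 \<mu>}}.
      sign \<pi> * ncprod (map (\<lambda>i. eP lt (int (conj_part \<mu> i) + int (\<pi> i) - int i)) [1..<part1 \<mu> + 1]) w)"

definition mP :: "('a \<Rightarrow> 'a \<Rightarrow> bool) \<Rightarrow> nat list \<Rightarrow> 'a ncpoly" where
  "mP lt la = (\<lambda>w. \<Sum>\<mu>\<in>partitions (sum_list la). kostka_inv (sum_list la) la \<mu> * JP lt \<mu> w)"

text \<open>A filling of shape la is represented by its list of columns, each column listed top to bottom;
  column c (0-indexed) has length la'_{c+1}.\<close>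
definition ptableau :: "('a \<Rightarrow> 'a \<Rightarrow> bool) \<Rightarrow> nat list \<Rightarrow> 'a list list \<Rightarrow> bool" where
  "ptableau lt la T \<longleftrightarrow> length T = part1 la
     \<and> (\<forall>c < length T. length (T ! c) = conj_part la (Suc c))
     \<and> (\<forall>c < length T. sorted_wrt lt (T ! c))
     \<and> (\<forall>c r. Suc c < length T \<longrightarrow> r < length (T ! Suc c) \<longrightarrow> \<not> lt (T ! Suc c ! r) (T ! c ! r))"

definition colword :: "'a list list \<Rightarrow> 'a list" where
  "colword T = concat (map rev T)"

text \<open>Ladders of (C, D): connected components of the bipartite graph inc_P(C,D) on the disjoint
  union C + D, with an edge c -- d whenever c ~_P d.\<close>
definition inc_edges :: "('a \<Rightarrow> 'a \<Rightarrow> bool) \<Rightarrow> 'a set \<Rightarrow> 'a set \<Rightarrow> ('a + 'a) rel" where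
  "inc_edges lt C D = {(Inl c, Inr d) | c d. c \<in> C \<and> d \<in> D \<and> sim lt c d}
                    \<union> {(Inr d, Inl c) | c d. c \<in> C \<and> d \<in> D \<and> sim lt c d}"

definition ladders :: "('a \<Rightarrow> 'a \<Rightarrow> bool) \<Rightarrow> 'a set \<Rightarrow> 'a set \<Rightarrow> ('a + 'a) set set" where
  "ladders lt C D = (\<lambda>v. {x \<in> Inl ` C \<union> Inr ` D. (v, x) \<in> (inc_edges lt C D)\<^sup>*}) ` (Inl ` C \<union> Inr ` D)"

definition balanced :: "'a set \<Rightarrow> 'a set \<Rightarrow> ('a + 'a) set \<Rightarrow> bool" where
  "balanced C D L \<longleftrightarrow> card (L \<inter> Inl ` C) = card (L \<inter> Inr ` D)"

definition left_unbalanced :: "'a set \<Rightarrow> 'a set \<Rightarrow> ('a + 'a) set \<Rightarrow> bool" where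
  "left_unbalanced C D L \<longleftrightarrow> card (L \<inter> Inl ` C) > card (L \<inter> Inr ` D)"

definition col1 :: "'a list list \<Rightarrow> 'a list" where
  "col1 T = (if length T \<ge> 1 then T ! 0 else [])"

definition col2 :: "'a list list \<Rightarrow> 'a list" where
  "col2 T = (if length T \<ge> 2 then T ! 1 else [])"

definition left_ptableau :: "('a \<Rightarrow> 'a \<Rightarrow> bool) \<Rightarrow> nat list \<Rightarrow> 'a list list \<Rightarrow> bool" where
  "left_ptableau lt la T \<longleftrightarrow> ptableau lt la T \<and> length T \<le> 2
     \<and> (\<forall>L \<in> ladders lt (set (col1 T)) (set (col2 T)).
          balanced (set (col1 T)) (set (col2 T)) L \<or> left_unbalanced (set (col1 T)) (set (col2 T)) L)"

definition LT :: "('a \<Rightarrow> 'a \<Rightarrow> bool) \<Rightarrow> nat list \<Rightarrow> 'a list list set" where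
  "LT lt la = {T. left_ptableau lt la T}"

definition LTsum :: "('a \<Rightarrow> 'a \<Rightarrow> bool) \<Rightarrow> nat list \<Rightarrow> 'a ncpoly" where
  "LTsum lt la = (\<lambda>w. \<Sum>T\<in>LT lt la. mono (colword T) w)"

end

(* Modulo the ideal, comparable letters commute, and a letter that is incomparable to exactly two
   elements of a chain commutes with the descending word of that chain. The connected components of the
   incomparability graph on C Un D have vertices of degree at most two, so an edge count shows that in a
   component with more elements of C than of D the excess is one and every element of D has exactly two
   neighbours in C. Exchanging the two sides of such a component therefore does not change the word of
   (C, D), and e_(n-q) e_q becomes the sum over a of binomial(n - 2a, q - a) times the sum over left
   tableaux of shape 2^a 1^(n-2a). Differences of these binomials are the two-column Kostka numbers, so the
   expansion of J is inverted by the inverse Kostka matrix, which is triangular for dominance. *)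

theory Submission
  imports Defs
begin

section \<open>Congruence of words\<close>

text \<open>Ladders live on the disjoint union of the two columns, but the exchange works with
  components of the plain set \<open>C \<union> D\<close>: this set and its components stay the same
  when the sides of a component are exchanged, so the same set of components undoes the exchange.
  (3+1)-freeness enters as the degree bound \<open>card_sim_chain_le\<close>. The obstacle is the
  row condition of a tableau, of which a pair of chains carries no trace. The edge count, applied to
  initial segments of the two chains, shows that it follows from the ladder condition. So left
  tableaux are just pairs of chains in which no component favours the second chain. The binomial
  arises because a left pair of sizes n - a and a has exactly n - 2a unbalanced components, of which
  q - a must be exchanged to reach sizes n - q and q. A row of the inverse Kostka matrix is
  supported on partitions dominated by its index, so only determinants of size at most two
  occur.\<close>

lemma ncmul_mono_left:
  "ncmul (mono p) f = (\<lambda>w. if take (length p) w = p then f (drop (length p) w) else 0)"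
proof
  fix w
  have "ncmul (mono p) f w = (\<Sum>i\<le>length w. if i = length p \<and> take i w = p then f (drop i w) else 0)"
    unfolding ncmul_def mono_def
    by (rule sum.cong) auto
  also have "\<dots> = (\<Sum>i\<le>length w. if i = length p then (if take (length p) w = p then f (drop (length p) w) else 0) else 0)"
    by (rule sum.cong) auto
  also have "\<dots> = (if take (length p) w = p then f (drop (length p) w) else 0)"
    using length_take[of "length p" w] by (auto simp: sum.delta)
  finally show "ncmul (mono p) f w = (if take (length p) w = p then f (drop (length p) w) else 0)" .
qed

text \<open>If \<open>s\<close> is longer than \<open>w\<close>, the truncated difference is 0 and
  the test becomes \<open>w = s\<close>, which fails on lengths, so the coefficient is correctly
  0.\<close>

lemma ncmul_mono_right:
  "ncmul f (mono s) = (\<lambda>w. if drop (length w - length s) w = s then f (take (length w - length s) w) else 0)"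
proof
  fix w
  have "ncmul f (mono s) w = (\<Sum>i\<le>length w. if i = length w - length s \<and> drop i w = s then f (take i w) else 0)"
    unfolding ncmul_def mono_def
    by (rule sum.cong) auto
  also have "\<dots> = (\<Sum>i\<le>length w. if i = length w - length s
      then (if drop (length w - length s) w = s then f (take (length w - length s) w) else 0) else 0)"
    by (rule sum.cong) auto
  also have "\<dots> = (if drop (length w - length s) w = s then f (take (length w - length s) w) else 0)"
    by (auto simp: sum.delta)
  finally show "ncmul f (mono s) w =
    (if drop (length w - length s) w = s then f (take (length w - length s) w) else 0)" .
qed

lemma ncmul_mono_mono: "ncmul (mono u) (mono v) = mono (u @ v)"
proof
  fix w
  have "w = u @ v \<longleftrightarrow> take (length u) w = u \<and> drop (length u) w = v"
    by (metis append_eq_conv_conj)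
  then show "ncmul (mono u) (mono v) w = mono (u @ v) w"
    unfolding ncmul_mono_left by (simp add: mono_def)
qed

lemma ncpoly_fin_mono: "ncpoly_fin (mono w)"
  by (simp add: ncpoly_fin_def mono_def)

lemma ncmul_ncsub_right: "ncmul p (ncsub f g) = ncsub (ncmul p f) (ncmul p g)"
  by (simp add: ncmul_def ncsub_def fun_eq_iff right_diff_distrib sum_subtractf)

lemma ncmul_ncsub_left: "ncmul (ncsub f g) p = ncsub (ncmul f p) (ncmul g p)"
  by (simp add: ncmul_def ncsub_def fun_eq_iff left_diff_distrib sum_subtractf)

text \<open>Scaling is left multiplication by the constant polynomial k. With k = -1 it makes the
  congruence symmetric.\<close>

lemma ideal_H_scale:
  assumes "f \<in> ideal_H lt"
  shows "(\<lambda>w. k * f w) \<in> ideal_H lt"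
proof -
  have "ncpoly_fin (\<lambda>w. k * mono [] w)"
    using finite_subset[of "{w. k * mono [] w \<noteq> 0}" "{[]}"] by (auto simp: ncpoly_fin_def mono_def)
  moreover have "ncmul (\<lambda>w. k * mono [] w) f = (\<lambda>w. k * ncmul (mono []) f w)"
    by (simp add: ncmul_def sum_distrib_left mult.assoc)
  ultimately show ?thesis
    using ideal_H.lmul[OF assms, of "\<lambda>w. k * mono [] w"] by (simp add: ncmul_mono_left)
qed

lemma congH_refl: "congH lt f f"
  using ideal_H.zero by (simp add: congH_def ncsub_def)

lemma congH_add:
  assumes "congH lt f f'" "congH lt g g'"
  shows "congH lt (\<lambda>w. f w + g w) (\<lambda>w. f' w + g' w)"
proof -
  have "ncsub (\<lambda>w. f w + g w) (\<lambda>w. f' w + g' w) = ncadd (ncsub f f') (ncsub g g')"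
    by (simp add: ncsub_def ncadd_def fun_eq_iff)
  then show ?thesis using assms ideal_H.add by (simp add: congH_def)
qed

lemma congH_scale:
  assumes "congH lt f f'"
  shows "congH lt (\<lambda>w. k * f w) (\<lambda>w. k * f' w)"
  using ideal_H_scale[of "ncsub f f'" lt k] assms
  by (simp add: congH_def ncsub_def right_diff_distrib)

lemma congH_sym: "congH lt f g \<Longrightarrow> congH lt g f"
  using ideal_H_scale[of "ncsub f g" lt "-1"] by (simp add: congH_def ncsub_def)

lemma congH_trans [trans]:
  assumes "congH lt f g" "congH lt g h"
  shows "congH lt f h"
proof -
  have "ncsub f h = ncadd (ncsub f g) (ncsub g h)"
    by (simp add: ncsub_def ncadd_def fun_eq_iff)
  then show ?thesis using assms ideal_H.add by (simp add: congH_def)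
qed

lemma congH_sum:
  assumes "\<And>i. i \<in> A \<Longrightarrow> congH lt (f i) (g i)"
  shows "congH lt (\<lambda>w. \<Sum>i\<in>A. f i w) (\<lambda>w. \<Sum>i\<in>A. g i w)"
  using assms
proof (induction A rule: infinite_finite_induct)
  case (insert x F)
  then show ?case using congH_add[of lt "f x" "g x"] by simp
qed (simp_all add: congH_refl)

definition weq :: "('a \<Rightarrow> 'a \<Rightarrow> bool) \<Rightarrow> 'a list \<Rightarrow> 'a list \<Rightarrow> bool" where
  "weq lt u v \<longleftrightarrow> congH lt (mono u) (mono v)"

lemma weq_refl: "weq lt u u"
  by (simp add: weq_def congH_refl)

lemma weq_sym: "weq lt u v \<Longrightarrow> weq lt v u"
  by (simp add: weq_def congH_sym)

lemma weq_trans [trans]: "weq lt u v \<Longrightarrow> weq lt v w \<Longrightarrow> weq lt u w"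
  unfolding weq_def by (rule congH_trans)

lemma weq_context:
  assumes "weq lt u v"
  shows "weq lt (p @ u @ s) (p @ v @ s)"
proof -
  have "ncmul (ncmul (mono p) (ncsub (mono u) (mono v))) (mono s) \<in> ideal_H lt"
    using assms by (intro ideal_H.rmul ideal_H.lmul ncpoly_fin_mono) (simp add: weq_def congH_def)
  then show ?thesis
    by (simp add: ncmul_ncsub_left ncmul_ncsub_right ncmul_mono_mono weq_def congH_def)
qed

lemma weq_prepend: "weq lt u v \<Longrightarrow> weq lt (p @ u) (p @ v)"
  using weq_context[of lt u v p "[]"] by simp

lemma weq_append: "weq lt u v \<Longrightarrow> weq lt (u @ s) (v @ s)"
  using weq_context[of lt u v "[]" s] by simp

lemma weq_gen2:
  assumes "sim lt a b" "sim lt b c" "lt a c"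
  shows "weq lt [c, a, b] [b, c, a]"
  using ideal_H.gen2[OF assms] by (simp add: weq_def congH_def)

text \<open>Equality belongs to this relation and, for a strict order, to \<open>sim\<close> as
  well; the two overlap in nothing else.\<close>

definition comparable :: "('a \<Rightarrow> 'a \<Rightarrow> bool) \<Rightarrow> 'a \<Rightarrow> 'a \<Rightarrow> bool" where
  "comparable lt x y \<longleftrightarrow> x = y \<or> lt x y \<or> lt y x"

lemma weq_swap:
  assumes "comparable lt x y"
  shows "weq lt [x, y] [y, x]"
proof -
  have "lt y x \<Longrightarrow> weq lt [x, y] [y, x]" "lt x y \<Longrightarrow> weq lt [y, x] [x, y]"
    using ideal_H.gen1[of lt] by (simp_all add: weq_def congH_def)
  then show ?thesis
    using assms weq_sym weq_refl unfolding comparable_def by metis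
qed

text \<open>The hypothesis is about the whole word \<open>u\<close>, since later \<open>y\<close>
  passes \<open>u\<close> without commuting with its single letters.\<close>

lemma weq_commute_letters:
  assumes "\<And>y. y \<in> set v \<Longrightarrow> weq lt (u @ [y]) (y # u)"
  shows "weq lt (u @ v) (v @ u)"
  using assms
proof (induction v)
  case Nil
  then show ?case by (simp add: weq_refl)
next
  case (Cons y v)
  have "weq lt ((u @ [y]) @ v) ((y # u) @ v)"
    using Cons.prems by (intro weq_append) simp
  also have "weq lt ((y # u) @ v) (y # v @ u)"
    using weq_prepend[of lt "u @ v" "v @ u" "[y]"] Cons by simp
  finally show ?case by simp
qed

lemma weq_commute_letter:
  assumes "\<And>x. x \<in> set u \<Longrightarrow> comparable lt x y"
  shows "weq lt (u @ [y]) (y # u)"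
proof -
  have "weq lt ([y] @ u) (u @ [y])"
  proof (rule weq_commute_letters)
    fix x assume "x \<in> set u"
    then have "comparable lt y x" using assms unfolding comparable_def by blast
    then show "weq lt ([y] @ [x]) (x # [y])" using weq_swap by simp
  qed
  then show ?thesis using weq_sym[of lt "y # u" "u @ [y]"] by simp
qed

lemma weq_mset:
  assumes "mset u = mset v" "\<And>x y. x \<in> set u \<Longrightarrow> y \<in> set u \<Longrightarrow> comparable lt x y"
  shows "weq lt u v"
  using assms
proof (induction u arbitrary: v)
  case Nil
  then show ?case by (simp add: weq_refl)
next
  case (Cons x u)
  have "x \<in> set v" using mset_eq_setD[OF Cons.prems(1)] by auto
  then obtain v1 v2 where v: "v = v1 @ x # v2" by (meson split_list)
  have "set v = set (x # u)" using mset_eq_setD[OF Cons.prems(1)] by simp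
  then have "weq lt (v1 @ [x]) (x # v1)"
    using Cons.prems(2) v by (intro weq_commute_letter) auto
  from weq_append[OF this, of v2] have "weq lt v (x # v1 @ v2)" using v by simp
  moreover have "weq lt u (v1 @ v2)"
    using Cons.prems v by (intro Cons.IH) auto
  from weq_prepend[OF this, of "[x]"] have "weq lt (x # u) (x # v1 @ v2)" by simp
  ultimately show ?case using weq_trans weq_sym[of lt v] by blast
qed

section \<open>Chains and incomparability components\<close>

definition is_chain :: "('a \<Rightarrow> 'a \<Rightarrow> bool) \<Rightarrow> 'a set \<Rightarrow> bool" where
  "is_chain lt A \<longleftrightarrow> (\<forall>x\<in>A. \<forall>y\<in>A. comparable lt x y)"

locale finite_31_free_poset =
  fixes lt :: "'a::finite \<Rightarrow> 'a \<Rightarrow> bool"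
  assumes strict: "strict_poset lt" and free: "free_3_1 lt"
begin

lemma lt_irrefl: "\<not> lt x x"
  using strict by (simp add: strict_poset_def)

lemma lt_trans: "lt x y \<Longrightarrow> lt y z \<Longrightarrow> lt x z"
  using strict unfolding strict_poset_def by blast

lemma lt_asym: "lt x y \<Longrightarrow> \<not> lt y x"
  using lt_irrefl lt_trans by blast

lemma sim_refl: "sim lt x x"
  by (simp add: sim_def lt_irrefl)

lemma sim_sym: "sim lt x y \<Longrightarrow> sim lt y x"
  by (simp add: sim_def)

lemma comparable_sym: "comparable lt x y \<Longrightarrow> comparable lt y x"
  by (auto simp: comparable_def)

lemma comparable_sim_eq: "comparable lt x y \<Longrightarrow> sim lt x y \<Longrightarrow> x = y"
  by (auto simp: comparable_def sim_def)

lemma not_sim_comparable: "\<not> sim lt x y \<Longrightarrow> comparable lt x y"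
  by (auto simp: comparable_def sim_def)

lemma is_chain_sim_eq: "is_chain lt C \<Longrightarrow> x \<in> C \<Longrightarrow> y \<in> C \<Longrightarrow> sim lt x y \<Longrightarrow> x = y"
  using comparable_sim_eq unfolding is_chain_def by blast

lemma is_chain_subset: "is_chain lt A \<Longrightarrow> B \<subseteq> A \<Longrightarrow> is_chain lt B"
  unfolding is_chain_def by blast

lemma sorted_wrt_lt_distinct: "sorted_wrt lt xs \<Longrightarrow> distinct xs"
  by (induction xs) (auto simp: lt_irrefl)

lemma sorted_wrt_lt_is_chain: "sorted_wrt lt xs \<Longrightarrow> is_chain lt (set xs)"
  by (induction xs) (auto simp: is_chain_def comparable_def)

lemma sorted_wrt_lt_unique:
  "sorted_wrt lt xs \<Longrightarrow> sorted_wrt lt ys \<Longrightarrow> set xs = set ys \<Longrightarrow> xs = ys"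
proof (induction xs arbitrary: ys)
  case (Cons x xs)
  then obtain y ys' where ys: "ys = y # ys'" by (cases ys) auto
  have "x = y"
  proof (rule ccontr)
    assume ne: "x \<noteq> y"
    have "y \<in> set (x # xs)" "x \<in> set (y # ys')"
      using Cons.prems(3) unfolding ys by (metis list.set_intros(1))+
    then have "lt x y" "lt y x" using Cons.prems(1,2) ne unfolding ys by auto
    then show False using lt_asym by blast
  qed
  moreover have "x \<notin> set xs" "y \<notin> set ys'"
    using Cons.prems(1,2) lt_irrefl unfolding ys by auto
  ultimately have "set xs = set ys'" using Cons.prems(3) unfolding ys by auto
  then have "xs = ys'" using Cons.prems(1,2) Cons.IH unfolding ys by simp
  then show ?case using \<open>x = y\<close> ys by simp
qed simp

lemma is_chain_sorted_list:
  assumes "is_chain lt A"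
  shows "\<exists>xs. sorted_wrt lt xs \<and> set xs = A"
  using finite[of A] assms
proof (induction A rule: finite_induct)
  case (insert x F)
  then obtain xs where xs: "sorted_wrt lt xs" "set xs = F"
    using is_chain_subset by blast
  let ?ys = "filter (\<lambda>y. lt y x) xs @ [x] @ filter (\<lambda>y. lt x y) xs"
  have "sorted_wrt lt ?ys"
    using xs(1) lt_trans by (auto simp: sorted_wrt_append intro: sorted_wrt_filter)
  moreover have "set ?ys = insert x F"
    using insert.prems insert.hyps xs(2) unfolding is_chain_def comparable_def by auto
  ultimately show ?case by blast
qed simp

text \<open>Chains are kept as sets, so that exchanging parts of them is set algebra;
  \<open>asc\<close> recovers the column and \<open>desc\<close> its reading word.\<close>

definition asc :: "'a set \<Rightarrow> 'a list" where
  "asc A = (THE xs. sorted_wrt lt xs \<and> set xs = A)"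

definition desc :: "'a set \<Rightarrow> 'a list" where
  "desc A = rev (asc A)"

lemma asc:
  assumes "is_chain lt A"
  shows "sorted_wrt lt (asc A)" "set (asc A) = A"
proof -
  have "\<exists>!xs. sorted_wrt lt xs \<and> set xs = A"
    using is_chain_sorted_list[OF assms] sorted_wrt_lt_unique by blast
  from theI'[OF this] show "sorted_wrt lt (asc A)" "set (asc A) = A"
    by (simp_all add: asc_def)
qed

lemma asc_set: "sorted_wrt lt xs \<Longrightarrow> asc (set xs) = xs"
  using asc[OF sorted_wrt_lt_is_chain] by (intro sorted_wrt_lt_unique) auto

lemma length_asc: "is_chain lt A \<Longrightarrow> length (asc A) = card A"
  using asc[of A] distinct_card[OF sorted_wrt_lt_distinct, of "asc A"] by simp

lemma set_desc: "is_chain lt A \<Longrightarrow> set (desc A) = A"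
  by (simp add: desc_def asc)

lemma mset_desc: "is_chain lt A \<Longrightarrow> mset (desc A) = mset_set A"
  using asc[of A] mset_set_set[OF sorted_wrt_lt_distinct, of "asc A"] by (simp add: desc_def)

lemma weq_desc_Un:
  assumes "is_chain lt (A \<union> B)" "A \<inter> B = {}"
  shows "weq lt (desc (A \<union> B)) (desc A @ desc B)"
proof (rule weq_mset)
  have "is_chain lt A" "is_chain lt B" using assms(1) is_chain_subset by blast+
  then show "mset (desc (A \<union> B)) = mset (desc A @ desc B)"
    using assms by (simp add: mset_desc mset_set_Union)
next
  fix x y assume "x \<in> set (desc (A \<union> B))" "y \<in> set (desc (A \<union> B))"
  then show "comparable lt x y" using assms(1) set_desc unfolding is_chain_def by blast
qed

text \<open>Letters comparable to \<open>d\<close> commute with it. The chain word may be rearranged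
  so that the two others stand last as \<open>[c, a]\<close>, and \<open>gen2\<close> carries
  \<open>d\<close> across both at once.\<close>

lemma weq_desc_commute_two_sim:
  assumes A: "is_chain lt A" and two: "card {c \<in> A. sim lt c d} = 2"
  shows "weq lt (desc A @ [d]) (d # desc A)"
proof -
  obtain a' c' where ac': "{c \<in> A. sim lt c d} = {a', c'}" "a' \<noteq> c'"
    using two by (meson card_2_iff)
  then have "comparable lt a' c'" using A unfolding is_chain_def by blast
  then obtain a c where ac: "{x \<in> A. sim lt x d} = {a, c}" "lt a c"
    using ac' unfolding comparable_def by (metis insert_commute)
  have ne: "a \<noteq> c" using ac(2) lt_irrefl by blast
  have mem: "a \<in> A" "c \<in> A" "sim lt a d" "sim lt c d" using ac(1) by auto
  let ?B = "A - {a, c}"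
  have B: "is_chain lt ?B" using A is_chain_subset by blast
  have "A = ?B \<union> {a, c}" using mem by blast
  then have "mset_set A = mset_set ?B + {#c, a#}"
    using ne mset_set_Union[of ?B "{a, c}"] by (simp add: add_mset_commute)
  then have eq: "weq lt (desc A) (desc ?B @ [c, a])"
    using A B set_desc[OF A] by (intro weq_mset) (auto simp: mset_desc is_chain_def)
  have "comparable lt x d" if "x \<in> ?B" for x
    using that ac(1) not_sim_comparable by blast
  then have com: "weq lt (desc ?B @ [d]) (d # desc ?B)"
    using set_desc[OF B] by (intro weq_commute_letter) blast
  have gen: "weq lt [c, a, d] [d, c, a]"
    using mem(3) sim_sym[OF mem(4)] ac(2) by (rule weq_gen2)
  have "weq lt (desc A @ [d]) (desc ?B @ [c, a, d])"
    using weq_append[OF eq, of "[d]"] by simp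
  also have "weq lt (desc ?B @ [c, a, d]) (desc ?B @ [d, c, a])"
    using weq_prepend[OF gen] by simp
  also have "weq lt (desc ?B @ [d, c, a]) (d # desc ?B @ [c, a])"
    using weq_append[OF com, of "[c, a]"] by simp
  also have "weq lt (d # desc ?B @ [c, a]) (d # desc A)"
    using weq_prepend[OF weq_sym[OF eq], of "[d]"] by simp
  finally show ?thesis .
qed

text \<open>Three such elements would form a chain of length three incomparable to \<open>d\<close>,
  a forbidden 3+1.\<close>

lemma card_sim_chain_le:
  assumes "is_chain lt C"
  shows "card {c \<in> C. sim lt c d} \<le> 2"
proof (rule ccontr)
  assume "\<not> ?thesis"
  then have "3 \<le> card {c \<in> C. sim lt c d}" by simp
  then obtain B where B: "B \<subseteq> {c \<in> C. sim lt c d}" "card B = 3"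
    by (meson obtain_subset_with_card_n)
  then obtain xs where xs: "sorted_wrt lt xs" "set xs = B"
    using is_chain_sorted_list[of B] is_chain_subset[OF assms, of B] by auto
  then have "length xs = 3" using B(2) distinct_card[OF sorted_wrt_lt_distinct, of xs] by simp
  then obtain a b c where "xs = [a, b, c]"
    by (auto simp: numeral_3_eq_3 length_Suc_conv)
  then have "lt a b" "lt b c" "sim lt d a" "sim lt d b" "sim lt d c"
    using xs B(1) sim_sym by auto
  then show False using free unfolding free_3_1_def by blast
qed

section \<open>Components of the incomparability graph and their edge count\<close>

definition component :: "'a set \<Rightarrow> 'a \<Rightarrow> 'a set" where
  "component U x = {y. (x, y) \<in> {(a, b). a \<in> U \<and> b \<in> U \<and> sim lt a b}\<^sup>*}"

definition components :: "'a set \<Rightarrow> 'a set set" where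
  "components U = component U ` U"

lemma component_self: "x \<in> component U x"
  by (simp add: component_def)

lemma component_step: "y \<in> component U x \<Longrightarrow> y \<in> U \<Longrightarrow> z \<in> U \<Longrightarrow> sim lt y z \<Longrightarrow> z \<in> component U x"
  unfolding component_def by (auto intro: rtrancl_into_rtrancl)

lemma component_subset: "x \<in> U \<Longrightarrow> component U x \<subseteq> U"
  unfolding component_def by (auto elim: rtranclE)

lemma component_eq:
  assumes "y \<in> component U x"
  shows "component U y = component U x"
proof -
  let ?R = "{(a, b). a \<in> U \<and> b \<in> U \<and> sim lt a b}"
  have "sym (?R\<^sup>*)" using sim_sym by (intro sym_rtrancl) (auto simp: sym_def)
  moreover have "(x, y) \<in> ?R\<^sup>*" using assms by (simp add: component_def)
  ultimately show ?thesis unfolding component_def by (auto dest: symD intro: rtrancl_trans)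
qed

lemma components_subset: "K \<in> components U \<Longrightarrow> K \<subseteq> U"
  using component_subset unfolding components_def by blast

lemma components_nonempty: "K \<in> components U \<Longrightarrow> K \<noteq> {}"
  using component_self unfolding components_def by blast

lemma Union_components: "\<Union> (components U) = U"
  using component_self component_subset unfolding components_def by blast

lemma components_disjoint: "K \<in> components U \<Longrightarrow> L \<in> components U \<Longrightarrow> K \<noteq> L \<Longrightarrow> K \<inter> L = {}"
  using component_eq unfolding components_def by blast

lemma components_sim_closed: "K \<in> components U \<Longrightarrow> x \<in> K \<Longrightarrow> y \<in> U \<Longrightarrow> sim lt x y \<Longrightarrow> y \<in> K"
  using component_step component_subset unfolding components_def by blast

text \<open>Connectedness in the form of a cut: a part \<open>A\<close> that no edge leaves would
  contain the whole component of each of its points.\<close>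

lemma components_connected:
  assumes "K \<in> components U" "A \<subseteq> K" "A \<noteq> {}" "A \<noteq> K"
  obtains x y where "x \<in> A" "y \<in> K" "y \<notin> A" "sim lt x y"
proof (rule ccontr)
  assume "\<not> thesis"
  then have no: "\<And>x y. x \<in> A \<Longrightarrow> y \<in> K \<Longrightarrow> sim lt x y \<Longrightarrow> y \<in> A" using that by blast
  obtain x where x: "x \<in> A" using assms(3) by blast
  have K: "K = component U x"
    using assms(1,2) x component_eq unfolding components_def by blast
  have "y \<in> A" if "y \<in> K" for y
    using that unfolding K component_def mem_Collect_eq
  proof (induction rule: rtrancl_induct)
    case (step y z)
    then have "z \<in> K" using assms(1,2) by (auto intro: components_sim_closed)
    then show ?case using step no by blast
  qed (rule x)
  then show False using assms(2,4) by blast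
qed

lemma card_eq_sum_components:
  assumes "A \<subseteq> U"
  shows "card A = (\<Sum>K\<in>components U. card (A \<inter> K))"
proof -
  have "A = (\<Union>K\<in>components U. A \<inter> K)" using assms Union_components by blast
  moreover have "card (\<Union>K\<in>components U. A \<inter> K) = (\<Sum>K\<in>components U. card (A \<inter> K))"
  proof (rule card_UN_disjoint)
    show "\<forall>K\<in>components U. \<forall>L\<in>components U. K \<noteq> L \<longrightarrow> A \<inter> K \<inter> (A \<inter> L) = {}"
      using components_disjoint by blast
  qed auto
  ultimately show ?thesis by simp
qed

text \<open>Edges carry their \<open>D\<close> end first, so the cardinality unfolds to the sum of
  the degrees of the elements of \<open>D\<close>.\<close>

abbreviation sim_edges :: "'a set \<Rightarrow> 'a set \<Rightarrow> ('a \<times> 'a) set" where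
  "sim_edges C D \<equiv> (SIGMA d:D. {c \<in> C. sim lt c d})"

text \<open>A connected graph on \<open>v\<close> vertices has at least \<open>v - 1\<close> edges; an element of \<open>C \<inter> D\<close>
  counts as two vertices joined by an edge.\<close>

lemma components_edge_bound:
  assumes C: "is_chain lt C" and D: "is_chain lt D" and K: "K \<in> components (C \<union> D)"
  shows "card (C \<inter> K) + card (D \<inter> K) \<le> 1 + card (sim_edges (C \<inter> K) (D \<inter> K))"
proof -
  have KU: "K \<subseteq> C \<union> D" using K components_subset by blast
  \<comment> \<open>A part of \<open>K\<close> is grown one vertex at a time along an edge leaving
    it, up to \<open>K\<close> itself.\<close>
  have "\<exists>A\<subseteq>K. card A = n \<and> card (C \<inter> A) + card (D \<inter> A) \<le> 1 + card (sim_edges (C \<inter> A) (D \<inter> A))"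
    if "1 \<le> n" "n \<le> card K" for n
    using that
  proof (induction n rule: dec_induct)
    case base
    obtain x where x: "x \<in> K" using components_nonempty[OF K] by blast
    \<comment> \<open>An element of both chains counts twice, and its loop \<open>(x, x)\<close> is
      the edge that pays for the second count.\<close>
    have "sim_edges {x} {x} = {(x, x)}" using sim_refl by auto
    then have "card (C \<inter> {x}) + card (D \<inter> {x}) \<le> 1 + card (sim_edges (C \<inter> {x}) (D \<inter> {x}))"
      by (cases "x \<in> C"; cases "x \<in> D") simp_all
    then show ?case using x by (intro exI[of _ "{x}"]) auto
  next
    case (step n)
    then obtain A where A: "A \<subseteq> K" "card A = n"
      and le: "card (C \<inter> A) + card (D \<inter> A) \<le> 1 + card (sim_edges (C \<inter> A) (D \<inter> A))" by auto
    have "A \<noteq> {}" "A \<noteq> K" using A step by auto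
    with K A(1) obtain u v where uv: "u \<in> A" "v \<in> K" "v \<notin> A" "sim lt u v"
      by (meson components_connected)
    have ne: "u \<noteq> v" using uv by blast
    have nC: "\<not> (u \<in> C \<and> v \<in> C)" and nD: "\<not> (u \<in> D \<and> v \<in> D)"
      using is_chain_sim_eq C D uv ne by blast+
    define e where "e = (if v \<in> C then (u, v) else (v, u))"
    let ?E = "sim_edges (C \<inter> A) (D \<inter> A)"
    have "insert e ?E \<subseteq> sim_edges (C \<inter> insert v A) (D \<inter> insert v A)"
      using uv KU A(1) nC nD sim_sym unfolding e_def by (auto split: if_splits)
    from card_mono[OF finite this]
    have "1 + card ?E \<le> card (sim_edges (C \<inter> insert v A) (D \<inter> insert v A))"
      using uv(3) unfolding e_def by (simp split: if_splits)
    \<comment> \<open>A new vertex lying in both chains would share a chain with \<open>u\<close>,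
      against \<open>nC\<close> or \<open>nD\<close>; so \<open>v\<close> is counted exactly
      once.\<close>
    moreover have "card (C \<inter> insert v A) + card (D \<inter> insert v A) = 1 + (card (C \<inter> A) + card (D \<inter> A))"
    proof (cases "v \<in> C")
      case True
      moreover have "v \<notin> D" using True nC nD uv KU A(1) by blast
      ultimately show ?thesis using uv(3) by simp
    next
      case False
      moreover have "v \<in> D" using False uv(2) KU by blast
      ultimately show ?thesis using uv(3) by simp
    qed
    ultimately show ?case using A uv(2,3) le by (intro exI[of _ "insert v A"]) auto
  qed
  moreover have "1 \<le> card K" using components_nonempty[OF K] by (simp add: Suc_le_eq card_gt_0_iff)
  ultimately obtain A where A: "A \<subseteq> K" "card A = card K"
    and le: "card (C \<inter> A) + card (D \<inter> A) \<le> 1 + card (sim_edges (C \<inter> A) (D \<inter> A))" by blast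
  have "A = K" using A card_subset_eq[OF finite] by blast
  then show ?thesis using le by simp
qed

text \<open>With c and d the sizes of the two sides, c + d \<le> 1 + (sum of degrees over
  \<open>D\<close>) \<le> 1 + 2d. If c > d, equality must hold throughout.\<close>

lemma left_unbalanced_component:
  assumes C: "is_chain lt C" and D: "is_chain lt D" and K: "K \<in> components (C \<union> D)"
    and less: "card (D \<inter> K) < card (C \<inter> K)"
  shows "card (C \<inter> K) = card (D \<inter> K) + 1"
    and "\<And>d. d \<in> D \<inter> K \<Longrightarrow> card {c \<in> C \<inter> K. sim lt c d} = 2"
proof -
  let ?deg = "\<lambda>d. card {c \<in> C \<inter> K. sim lt c d}"
  have le: "?deg d \<le> 2" for d
    using card_sim_chain_le[of "C \<inter> K" d] C is_chain_subset by blast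
  have E: "card (sim_edges (C \<inter> K) (D \<inter> K)) = (\<Sum>d\<in>D \<inter> K. ?deg d)" by simp
  have bound: "card (C \<inter> K) + card (D \<inter> K) \<le> 1 + (\<Sum>d\<in>D \<inter> K. ?deg d)"
    using components_edge_bound[OF C D K] unfolding E .
  have sum_le: "(\<Sum>d\<in>D \<inter> K. ?deg d) \<le> 2 * card (D \<inter> K)"
    using sum_bounded_above[of "D \<inter> K" ?deg 2] le by simp
  then show "card (C \<inter> K) = card (D \<inter> K) + 1" using bound less by linarith
  show "?deg d = 2" if d: "d \<in> D \<inter> K" for d
  proof (rule ccontr)
    assume "?deg d \<noteq> 2"
    then have "?deg d < 2" using le[of d] by linarith
    then have "(\<Sum>d\<in>D \<inter> K. ?deg d) < (\<Sum>d\<in>D \<inter> K. 2)"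
      using d le by (intro sum_strict_mono_ex1) auto
    then show False using bound less by simp
  qed
qed

text \<open>In a component on which \<open>C\<close> weakly dominates, suppose \<open>d < c\<close> at equal height \<open>r\<close>. Splitting the edges
  between \<open>C\<close> and \<open>D\<close> at \<open>c\<close> and \<open>d\<close>, every edge meets either the part of \<open>C\<close> below \<open>c\<close> or the part of \<open>D\<close> above \<open>d\<close>;
  as degrees are at most two, some component has too few edges to be connected.\<close>

lemma left_heights:
  assumes C: "is_chain lt C" and D: "is_chain lt D"
    and left: "\<And>K. K \<in> components (C \<union> D) \<Longrightarrow> card (D \<inter> K) \<le> card (C \<inter> K)"
    and cd: "c \<in> C" "d \<in> D" "lt d c"
  shows "card {y \<in> D. lt y d} \<noteq> card {x \<in> C. lt x c}"
proof
  assume eq: "card {y \<in> D. lt y d} = card {x \<in> C. lt x c}"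
  \<comment> \<open>\<open>B\<close> is the initial segment of \<open>D\<close> ending in
    \<open>d\<close>, one larger than the initial segment \<open>Z\<close> of \<open>C\<close>
    strictly below \<open>c\<close>; so some component contains more of \<open>B\<close> than of
    \<open>Z\<close>. A neighbour in \<open>C\<close> of an element of \<open>B\<close> cannot be
    \<open>c\<close> or above it, as that element is below \<open>c\<close>; it lies in
    \<open>Z\<close>.\<close>
  define Z where "Z = {x \<in> C. lt x c}"
  define B where "B = insert d {y \<in> D. lt y d}"
  have "card B = card Z + 1"
    unfolding B_def Z_def using eq lt_irrefl by simp
  moreover have "Z \<subseteq> C \<union> D" "B \<subseteq> C \<union> D" unfolding B_def Z_def using cd by auto
  ultimately have "(\<Sum>K\<in>components (C \<union> D). card (Z \<inter> K)) < (\<Sum>K\<in>components (C \<union> D). card (B \<inter> K))"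
    using card_eq_sum_components[of Z "C \<union> D"] card_eq_sum_components[of B "C \<union> D"] by linarith
  then obtain K where K: "K \<in> components (C \<union> D)" and less: "card (Z \<inter> K) < card (B \<inter> K)"
    by (meson not_le sum_mono)
  have le2: "card {x \<in> C \<inter> K. sim lt x y} \<le> 2" for y
    using card_sim_chain_le[of "C \<inter> K" y] is_chain_subset[OF C] by blast
  have le2': "card {y \<in> D \<inter> K. sim lt y x} \<le> 2" for x
    using card_sim_chain_le[of "D \<inter> K" x] is_chain_subset[OF D] by blast
  let ?D' = "D \<inter> K - B"
  let ?E1 = "SIGMA x:Z \<inter> K. {y \<in> D \<inter> K. sim lt y x}"
  let ?E2 = "sim_edges (C \<inter> K) ?D'"
  have sub: "sim_edges (C \<inter> K) (D \<inter> K) \<subseteq> prod.swap ` ?E1 \<union> ?E2"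
  proof
    fix p assume "p \<in> sim_edges (C \<inter> K) (D \<inter> K)"
    then obtain y x where p: "p = (y, x)" "y \<in> D" "y \<in> K" "x \<in> C" "x \<in> K" "sim lt x y" by auto
    show "p \<in> prod.swap ` ?E1 \<union> ?E2"
    proof (cases "y \<in> B")
      case True
      have "\<not> lt c x \<and> x \<noteq> c"
      proof (rule ccontr)
        assume "\<not> ?thesis"
        moreover have "y = d \<or> lt y d" using True by (auto simp: B_def)
        ultimately have "lt y x" using cd(3) lt_trans by blast
        then show False using p(6) by (simp add: sim_def)
      qed
      then have "x \<in> Z" using C p(4) cd(1) unfolding Z_def is_chain_def comparable_def by blast
      then have "(x, y) \<in> ?E1" using p sim_sym by auto
      then show ?thesis using p(1) by force
    next
      case False
      then show ?thesis using p by auto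
    qed
  qed
  have "card ?E1 \<le> 2 * card (Z \<inter> K)"
    using sum_bounded_above[of "Z \<inter> K" "\<lambda>x. card {y \<in> D \<inter> K. sim lt y x}" 2] le2' by simp
  moreover have "card (prod.swap ` ?E1) \<le> card ?E1" by (rule card_image_le) simp
  moreover have "card ?E2 \<le> 2 * card ?D'"
    using sum_bounded_above[of ?D' "\<lambda>y. card {x \<in> C \<inter> K. sim lt x y}" 2] le2 by simp
  moreover have "card (sim_edges (C \<inter> K) (D \<inter> K)) \<le> card (prod.swap ` ?E1) + card ?E2"
    using card_mono[OF finite sub] card_Un_le[of "prod.swap ` ?E1" ?E2] by linarith
  moreover have "card (C \<inter> K) + card (D \<inter> K) \<le> 1 + card (sim_edges (C \<inter> K) (D \<inter> K))"
    by (rule components_edge_bound[OF C D K])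
  moreover have "card (D \<inter> K) = card (B \<inter> K) + card ?D'"
  proof -
    have "D \<inter> K = (B \<inter> K) \<union> ?D'" using cd(2) unfolding B_def by blast
    then show ?thesis using card_Un_disjoint[of "B \<inter> K" ?D'] by auto
  qed
  \<comment> \<open>The edges in \<open>K\<close> number at most 2|Z \<inter> K| + 2|D \<inter> K -
    B| \<le> 2|D \<inter> K| - 2, but connectedness and dominance of \<open>C\<close> require at
    least 2|D \<inter> K| - 1.\<close>
  ultimately show False using left[OF K] less by linarith
qed

section \<open>Exchanging the two sides of components\<close>

text \<open>This is one chain after the exchange; the new pair is
  \<open>(swapped C D R, swapped D C R)\<close>.\<close>

definition swapped :: "'a set \<Rightarrow> 'a set \<Rightarrow> 'a set set \<Rightarrow> 'a set" where
  "swapped C D R = (C - \<Union>R) \<union> (D \<inter> \<Union>R)"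

definition left_dominant :: "'a set \<Rightarrow> 'a set \<Rightarrow> 'a set set" where
  "left_dominant C D = {K \<in> components (C \<union> D). card (D \<inter> K) < card (C \<inter> K)}"

definition chain_pairs :: "('a set \<times> 'a set) set" where
  "chain_pairs = {(C, D). is_chain lt C \<and> is_chain lt D}"

text \<open>With its arguments reversed, \<open>left_dominant D C\<close> collects the components in
  which \<open>D\<close> has more elements.\<close>

definition left_pairs :: "('a set \<times> 'a set) set" where
  "left_pairs = {(C, D) \<in> chain_pairs. left_dominant D C = {}}"

definition pair_word :: "'a set \<times> 'a set \<Rightarrow> 'a list" where
  "pair_word X = desc (fst X) @ desc (snd X)"

lemma left_pairs_le:
  "(C, D) \<in> left_pairs \<Longrightarrow> K \<in> components (C \<union> D) \<Longrightarrow> card (D \<inter> K) \<le> card (C \<inter> K)"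
  by (auto simp: left_pairs_def left_dominant_def Un_commute not_less)

lemma left_dominant_subset: "left_dominant C D \<subseteq> components (C \<union> D)" "left_dominant D C \<subseteq> components (C \<union> D)"
  by (auto simp: left_dominant_def Un_commute)

lemma swapped_Un: "swapped C D R \<union> swapped D C R = C \<union> D"
  unfolding swapped_def by blast

lemma swapped_twice: "swapped (swapped C D R) (swapped D C R) R = C"
  unfolding swapped_def by blast

lemma swapped_Int:
  assumes "R \<subseteq> components (C \<union> D)" "K \<in> components (C \<union> D)"
  shows "swapped C D R \<inter> K = (if K \<in> R then D \<inter> K else C \<inter> K)"
proof (cases "K \<in> R")
  case False
  then have "K \<inter> \<Union>R = {}" using assms components_disjoint by blast
  then show ?thesis using False unfolding swapped_def by auto
qed (auto simp: swapped_def)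

text \<open>Elements of different components are comparable, since an incomparability would join the
  components.\<close>

lemma is_chain_swapped:
  assumes C: "is_chain lt C" and D: "is_chain lt D" and R: "R \<subseteq> components (C \<union> D)"
  shows "is_chain lt (swapped C D R)"
proof -
  have "comparable lt x y" if x: "x \<in> C - \<Union>R" and y: "y \<in> D \<inter> \<Union>R" for x y
  proof (rule not_sim_comparable, rule)
    assume "sim lt x y"
    moreover obtain K where "K \<in> R" "y \<in> K" using y by blast
    ultimately have "x \<in> K" using components_sim_closed[of K _ y x] R sim_sym x by blast
    then show False using x \<open>K \<in> R\<close> by blast
  qed
  then show ?thesis
    using C D comparable_sym unfolding is_chain_def swapped_def by blast
qed

lemma weq_pair_word_swapped:
  assumes X: "(C, D) \<in> chain_pairs" and R: "R \<subseteq> left_dominant C D"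
  shows "weq lt (pair_word (swapped C D R, swapped D C R)) (pair_word (C, D))"
proof -
  have C: "is_chain lt C" and D: "is_chain lt D" using X by (auto simp: chain_pairs_def)
  have Rc: "R \<subseteq> components (C \<union> D)" using R left_dominant_subset by blast
  let ?S = "\<Union>R"
  have chains: "is_chain lt (C \<inter> ?S)" "is_chain lt (C - ?S)" "is_chain lt (D \<inter> ?S)" "is_chain lt (D - ?S)"
    using C D is_chain_subset by blast+
  have "weq lt (desc (C \<inter> ?S) @ [d]) (d # desc (C \<inter> ?S))" if "d \<in> set (desc (D \<inter> ?S))" for d
  proof (rule weq_desc_commute_two_sim[OF chains(1)])
    have "d \<in> D \<inter> ?S" using that chains(3) set_desc by blast
    then obtain K where K: "K \<in> R" "d \<in> D \<inter> K" by blast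
    have Kc: "K \<in> components (C \<union> D)" and "card (D \<inter> K) < card (C \<inter> K)"
      using K(1) R by (auto simp: left_dominant_def)
    then have "card {c \<in> C \<inter> K. sim lt c d} = 2"
      using left_unbalanced_component(2)[OF C D _ _ K(2)] by blast
    \<comment> \<open>All neighbours of \<open>d\<close> lie in its own component, so other
      exchanged components do not alter the count of two.\<close>
    moreover have "{c \<in> C \<inter> ?S. sim lt c d} = {c \<in> C \<inter> K. sim lt c d}"
      using K components_sim_closed[OF Kc, of d] sim_sym by blast
    ultimately show "card {c \<in> C \<inter> ?S. sim lt c d} = 2" by simp
  qed
  then have com: "weq lt (desc (C \<inter> ?S) @ desc (D \<inter> ?S)) (desc (D \<inter> ?S) @ desc (C \<inter> ?S))"
    by (rule weq_commute_letters)
  \<comment> \<open>Both orders are needed: the exchanged part goes to the end of the word of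
    \<open>C\<close> and to the front of the word of \<open>D\<close>, so that the two parts become
    adjacent.\<close>
  have split: "weq lt (desc E) (desc (E - ?S) @ desc (E \<inter> ?S))" "weq lt (desc E) (desc (E \<inter> ?S) @ desc (E - ?S))"
    if "is_chain lt E" for E
  proof -
    have "E - ?S \<union> E \<inter> ?S = E" "E \<inter> ?S \<union> (E - ?S) = E" "(E - ?S) \<inter> (E \<inter> ?S) = {}" "(E \<inter> ?S) \<inter> (E - ?S) = {}"
      by blast+
    then show "weq lt (desc E) (desc (E - ?S) @ desc (E \<inter> ?S))" "weq lt (desc E) (desc (E \<inter> ?S) @ desc (E - ?S))"
      using that weq_desc_Un[of "E - ?S" "E \<inter> ?S"] weq_desc_Un[of "E \<inter> ?S" "E - ?S"] by simp_all
  qed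
  have "weq lt (desc C @ desc D) ((desc (C - ?S) @ desc (C \<inter> ?S)) @ (desc (D \<inter> ?S) @ desc (D - ?S)))"
    by (rule weq_trans[OF weq_append[OF split(1)[OF C]] weq_prepend[OF split(2)[OF D]]])
  also have "weq lt \<dots> ((desc (C - ?S) @ desc (D \<inter> ?S)) @ (desc (C \<inter> ?S) @ desc (D - ?S)))"
    using weq_context[OF com, of "desc (C - ?S)" "desc (D - ?S)"] by simp
  also have "weq lt \<dots> (desc (swapped C D R) @ desc (swapped D C R))"
  proof -
    have "is_chain lt (swapped C D R)" "is_chain lt (swapped D C R)"
      using is_chain_swapped C D Rc by (simp_all add: Un_commute)
    moreover have "swapped C D R = (C - ?S) \<union> (D \<inter> ?S)" "swapped D C R = (C \<inter> ?S) \<union> (D - ?S)"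
      unfolding swapped_def by blast+
    moreover have "(C - ?S) \<inter> (D \<inter> ?S) = {}" "(C \<inter> ?S) \<inter> (D - ?S) = {}" by blast+
    ultimately have "weq lt (desc (swapped C D R)) (desc (C - ?S) @ desc (D \<inter> ?S))"
      and "weq lt (desc (swapped D C R)) (desc (C \<inter> ?S) @ desc (D - ?S))"
      using weq_desc_Un[of "C - ?S" "D \<inter> ?S"] weq_desc_Un[of "C \<inter> ?S" "D - ?S"] by simp_all
    from weq_trans[OF weq_append[OF this(1)] weq_prepend[OF this(2)]] show ?thesis by (rule weq_sym)
  qed
  finally show ?thesis unfolding pair_word_def fst_conv snd_conv by (rule weq_sym)
qed

lemma card_swapped:
  assumes X: "(C, D) \<in> chain_pairs" and R: "R \<subseteq> left_dominant C D"
  shows "card (swapped D C R) = card D + card R"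
proof -
  have C: "is_chain lt C" and D: "is_chain lt D" using X by (auto simp: chain_pairs_def)
  have Rc: "R \<subseteq> components (C \<union> D)" using R left_dominant_subset by blast
  have "card (swapped D C R \<inter> K) = card (D \<inter> K) + (if K \<in> R then 1 else 0)" if "K \<in> components (C \<union> D)" for K
  proof (cases "K \<in> R")
    case True
    then have "card (C \<inter> K) = card (D \<inter> K) + 1"
      using R left_unbalanced_component(1)[OF C D that] by (auto simp: left_dominant_def)
    then show ?thesis using True swapped_Int[of R D C K] Rc that by (simp add: Un_commute)
  next
    case False
    then show ?thesis using swapped_Int[of R D C K] Rc that by (simp add: Un_commute)
  qed
  moreover have "swapped D C R \<subseteq> C \<union> D" unfolding swapped_def by blast
  ultimately have "card (swapped D C R) = (\<Sum>K\<in>components (C \<union> D). card (D \<inter> K) + (if K \<in> R then 1 else 0))"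
    using card_eq_sum_components[of "swapped D C R" "C \<union> D"] by simp
  also have "\<dots> = card D + card (components (C \<union> D) \<inter> R)"
    using card_eq_sum_components[of D "C \<union> D"] by (simp add: sum.distrib sum.If_cases)
  also have "components (C \<union> D) \<inter> R = R" using Rc by blast
  finally show ?thesis .
qed

lemma card_swapped_add:
  assumes "R \<subseteq> components (C \<union> D)"
  shows "card (swapped C D R) + card (swapped D C R) = card C + card D"
proof -
  have "card (swapped C D R \<inter> K) + card (swapped D C R \<inter> K) = card (C \<inter> K) + card (D \<inter> K)"
    if "K \<in> components (C \<union> D)" for K
    using swapped_Int[of R C D K] swapped_Int[of R D C K] that assms by (simp add: Un_commute)
  then have "(\<Sum>K\<in>components (C \<union> D). card (swapped C D R \<inter> K) + card (swapped D C R \<inter> K))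
      = (\<Sum>K\<in>components (C \<union> D). card (C \<inter> K) + card (D \<inter> K))"
    by simp
  moreover have "swapped C D R \<subseteq> C \<union> D" "swapped D C R \<subseteq> C \<union> D" unfolding swapped_def by blast+
  ultimately show ?thesis
    using card_eq_sum_components[of _ "C \<union> D"] by (simp add: sum.distrib)
qed

text \<open>Each component has excess 0 or 1, so the number of unbalanced ones depends only on the
  sizes of the chains. It becomes the upper entry of the binomial.\<close>

lemma card_left_dominant:
  assumes "(C, D) \<in> left_pairs"
  shows "card C = card D + card (left_dominant C D)"
proof -
  have X: "(C, D) \<in> chain_pairs" using assms by (simp add: left_pairs_def)
  then have C: "is_chain lt C" and D: "is_chain lt D" by (auto simp: chain_pairs_def)
  have "card (C \<inter> K) = card (D \<inter> K) + (if K \<in> left_dominant C D then 1 else 0)"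
    if "K \<in> components (C \<union> D)" for K
    using left_pairs_le[OF assms that] left_unbalanced_component(1)[OF C D that] that
    by (auto simp: left_dominant_def)
  then have "card C = (\<Sum>K\<in>components (C \<union> D). card (D \<inter> K) + (if K \<in> left_dominant C D then 1 else 0))"
    using card_eq_sum_components[of C "C \<union> D"] by simp
  also have "\<dots> = card D + card (components (C \<union> D) \<inter> left_dominant C D)"
    using card_eq_sum_components[of D "C \<union> D"] by (simp add: sum.distrib sum.If_cases)
  also have "components (C \<union> D) \<inter> left_dominant C D = left_dominant C D"
    using left_dominant_subset by blast
  finally show ?thesis .
qed

text \<open>The exchanged set can be read off from the result, which makes the exchange
  injective.\<close>

lemma swapped_left_dominant_reverse:
  assumes "R \<subseteq> left_dominant C D" "(C, D) \<in> left_pairs"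
  shows "left_dominant (swapped D C R) (swapped C D R) = R"
proof -
  have Rc: "R \<subseteq> components (C \<union> D)" using assms left_dominant_subset by blast
  have U: "swapped D C R \<union> swapped C D R = C \<union> D" using swapped_Un[of D C R] by (simp add: Un_commute)
  have "card (swapped C D R \<inter> K) < card (swapped D C R \<inter> K) \<longleftrightarrow> K \<in> R" if "K \<in> components (C \<union> D)" for K
    using that swapped_Int[of R C D K] swapped_Int[of R D C K] Rc assms(1) left_pairs_le[OF assms(2) that]
    by (auto simp: Un_commute left_dominant_def)
  then show ?thesis using Rc unfolding left_dominant_def[of "swapped D C R"] U by blast
qed

text \<open>Every pair of chains arises from a left pair: exchange all components in which the
  second chain is larger.\<close>

lemma swapped_right_dominant:
  assumes "(C, D) \<in> chain_pairs"
  defines "R \<equiv> left_dominant D C"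
  shows "(swapped C D R, swapped D C R) \<in> left_pairs"
    and "R \<subseteq> left_dominant (swapped C D R) (swapped D C R)"
proof -
  have Rc: "R \<subseteq> components (C \<union> D)" unfolding R_def by (rule left_dominant_subset)
  have CD: "is_chain lt C" "is_chain lt D" using assms(1) by (auto simp: chain_pairs_def)
  have ch: "(swapped C D R, swapped D C R) \<in> chain_pairs"
    using is_chain_swapped CD Rc by (simp add: chain_pairs_def Un_commute)
  have mem: "K \<in> R \<longleftrightarrow> card (C \<inter> K) < card (D \<inter> K)" if "K \<in> components (C \<union> D)" for K
    using that by (simp add: R_def left_dominant_def Un_commute)
  have "card (swapped D C R \<inter> K) \<le> card (swapped C D R \<inter> K)
      \<and> (K \<in> R \<longrightarrow> card (swapped D C R \<inter> K) < card (swapped C D R \<inter> K))" if "K \<in> components (C \<union> D)" for K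
    using that swapped_Int[of R C D K] swapped_Int[of R D C K] Rc mem[OF that] by (auto simp: Un_commute)
  moreover have "swapped C D R \<union> swapped D C R = C \<union> D" "swapped D C R \<union> swapped C D R = C \<union> D"
    using swapped_Un[of C D R] swapped_Un[of D C R] by (simp_all add: Un_commute)
  ultimately show "(swapped C D R, swapped D C R) \<in> left_pairs"
    and "R \<subseteq> left_dominant (swapped C D R) (swapped D C R)"
    using ch Rc by (auto simp: left_pairs_def left_dominant_def not_less)
qed

end

section \<open>Products of elementary functions\<close>

lemma ncmul_sum_left: "ncmul (\<lambda>w. \<Sum>i\<in>A. f i w) g = (\<lambda>w. \<Sum>i\<in>A. ncmul (f i) g w)"
  unfolding ncmul_def sum_distrib_right by (rule ext, rule sum.swap)

lemma ncmul_sum_right: "ncmul f (\<lambda>w. \<Sum>i\<in>A. g i w) = (\<lambda>w. \<Sum>i\<in>A. ncmul f (g i) w)"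
  unfolding ncmul_def sum_distrib_left by (rule ext, rule sum.swap)

text \<open>The guard is needed because truncated subtraction would turn the case
  \<open>q < a\<close> into \<open>m choose 0\<close>, which is 1.\<close>

definition binomial_diff :: "nat \<Rightarrow> nat \<Rightarrow> nat \<Rightarrow> nat" where
  "binomial_diff m q a = (if q < a then 0 else m choose (q - a))"

definition two_col :: "nat \<Rightarrow> nat \<Rightarrow> nat list" where
  "two_col n a = replicate a 2 @ replicate (n - 2 * a) 1"

context finite_31_free_poset
begin

lemma eP_eq_sum_desc:
  "eP lt (int p) = (\<lambda>w. \<Sum>A | is_chain lt A \<and> card A = p. mono (desc A) w)"
proof
  fix w
  \<comment> \<open>A chain is the set of letters of its word, so at most the term
    \<open>A = set w\<close> survives.\<close>
  have "(\<Sum>A | is_chain lt A \<and> card A = p. mono (desc A) w)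
      = (\<Sum>A | is_chain lt A \<and> card A = p. if A = set w then mono (desc A) w else 0)"
  proof (rule sum.cong)
    fix A assume "A \<in> {A. is_chain lt A \<and> card A = p}"
    then have "set (desc A) = A" using set_desc by blast
    then show "mono (desc A) w = (if A = set w then mono (desc A) w else 0)"
      by (auto simp: mono_def)
  qed simp
  also have "\<dots> = (if is_chain lt (set w) \<and> card (set w) = p then mono (desc (set w)) w else 0)"
    by (simp add: sum.delta)
  also have "\<dots> = eP lt (int p) w"
  proof (cases "sorted_wrt lt (rev w)")
    case True
    then have "desc (set w) = w" "is_chain lt (set w)" "length w = card (set w)"
      using asc_set[of "rev w"] sorted_wrt_lt_is_chain[of "rev w"] sorted_wrt_lt_distinct[of "rev w"]
      by (simp_all add: desc_def distinct_card)
    then show ?thesis using True by (auto simp: eP_def mono_def sorted_wrt_rev)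
  next
    case False
    then have "\<not> (is_chain lt (set w) \<and> w = desc (set w))"
      using asc(1)[of "set w"] unfolding desc_def by (metis rev_rev_ident)
    then show ?thesis using False by (auto simp: eP_def mono_def sorted_wrt_rev)
  qed
  finally show "eP lt (int p) w = (\<Sum>A | is_chain lt A \<and> card A = p. mono (desc A) w)" by simp
qed

lemma ncmul_eP_eP:
  "ncmul (eP lt (int p)) (eP lt (int q)) =
     (\<lambda>w. \<Sum>X | X \<in> chain_pairs \<and> card (fst X) = p \<and> card (snd X) = q. mono (pair_word X) w)"
proof
  fix w
  have "ncmul (eP lt (int p)) (eP lt (int q)) w =
      (\<Sum>A | is_chain lt A \<and> card A = p. \<Sum>B | is_chain lt B \<and> card B = q. mono (desc A @ desc B) w)"
    unfolding eP_eq_sum_desc ncmul_sum_left ncmul_sum_right ncmul_mono_mono by simp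
  also have "\<dots> = (\<Sum>(A, B)\<in>{A. is_chain lt A \<and> card A = p} \<times> {B. is_chain lt B \<and> card B = q}. mono (desc A @ desc B) w)"
    by (rule sum.cartesian_product)
  also have "\<dots> = (\<Sum>X | X \<in> chain_pairs \<and> card (fst X) = p \<and> card (snd X) = q. mono (pair_word X) w)"
    by (rule sum.cong) (auto simp: chain_pairs_def pair_word_def)
  finally show "ncmul (eP lt (int p)) (eP lt (int q)) w =
     (\<Sum>X | X \<in> chain_pairs \<and> card (fst X) = p \<and> card (snd X) = q. mono (pair_word X) w)" .
qed

definition left_pairs_of :: "nat \<Rightarrow> nat \<Rightarrow> ('a set \<times> 'a set) set" where
  "left_pairs_of n a = {X \<in> left_pairs. card (fst X) + card (snd X) = n \<and> card (snd X) = a}"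

text \<open>Exchanging the left unbalanced components in a subset \<open>R\<close> produces every pair of chains
  exactly once from a left pair.\<close>

lemma sum_chain_pairs_reindex:
  "(\<Sum>X | X \<in> chain_pairs \<and> card (fst X) = p \<and> card (snd X) = q. f X) =
   (\<Sum>Y | Y \<in> left_pairs \<and> card (fst Y) + card (snd Y) = p + q.
      \<Sum>R | R \<subseteq> left_dominant (fst Y) (snd Y) \<and> card (snd Y) + card R = q.
        (f (swapped (fst Y) (snd Y) R, swapped (snd Y) (fst Y) R) :: int))" (is "?lhs = ?rhs")
proof -
  let ?I = "SIGMA Y:{Y. Y \<in> left_pairs \<and> card (fst Y) + card (snd Y) = p + q}.
    {R. R \<subseteq> left_dominant (fst Y) (snd Y) \<and> card (snd Y) + card R = q}"
  let ?\<phi> = "\<lambda>(Y, R). (swapped (fst Y) (snd Y) R, swapped (snd Y) (fst Y) R)"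
  \<comment> \<open>The inverse takes for \<open>R\<close> the components in which the second chain
    is larger and exchanges them back.\<close>
  let ?\<psi> = "\<lambda>X. ((swapped (fst X) (snd X) (left_dominant (snd X) (fst X)),
      swapped (snd X) (fst X) (left_dominant (snd X) (fst X))), left_dominant (snd X) (fst X))"
  have "?rhs = (\<Sum>i\<in>?I. f (?\<phi> i))"
    by (simp add: sum.Sigma case_prod_unfold)
  also have "\<dots> = ?lhs"
  proof (rule sum.reindex_bij_witness[where i = ?\<psi> and j = ?\<phi>])
    fix i assume I: "i \<in> ?I"
    obtain C D R where eq: "i = ((C, D), R)" by (cases i, cases "fst i") auto
    with I have i: "i = ((C, D), R)" "(C, D) \<in> left_pairs" "card C + card D = p + q"
      "R \<subseteq> left_dominant C D" "card D + card R = q" by simp_all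
    then have X: "(C, D) \<in> chain_pairs" by (simp add: left_pairs_def)
    have Rc: "R \<subseteq> components (C \<union> D)" using i(4) left_dominant_subset by blast
    show "?\<psi> (?\<phi> i) = i"
      using swapped_left_dominant_reverse[OF i(4,2)] by (simp add: i(1) swapped_twice)
    have "is_chain lt (swapped C D R)" "is_chain lt (swapped D C R)"
      using X Rc is_chain_swapped[of C D R] is_chain_swapped[of D C R] by (simp_all add: chain_pairs_def Un_commute)
    moreover have "card (swapped D C R) = q" using card_swapped[OF X i(4)] i(5) by simp
    moreover have "card (swapped C D R) = p"
      using card_swapped_add[OF Rc] i(3) calculation(3) by simp
    ultimately show "?\<phi> i \<in> {X. X \<in> chain_pairs \<and> card (fst X) = p \<and> card (snd X) = q}"
      by (simp add: i(1) chain_pairs_def)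
  next
    fix X assume "X \<in> {X. X \<in> chain_pairs \<and> card (fst X) = p \<and> card (snd X) = q}"
    then obtain C D where X: "X = (C, D)" "(C, D) \<in> chain_pairs" "card C = p" "card D = q"
      by (cases X) auto
    let ?R = "left_dominant D C"
    show "?\<phi> (?\<psi> X) = X" by (simp add: X(1) swapped_twice)
    note left = swapped_right_dominant[OF X(2)]
    then have ch: "(swapped C D ?R, swapped D C ?R) \<in> chain_pairs" by (simp add: left_pairs_def)
    have "card (swapped C D ?R) + card (swapped D C ?R) = p + q"
      using card_swapped_add[OF left_dominant_subset(2)] X(3,4) by simp
    moreover have "card (swapped D C ?R) + card ?R = q"
      using card_swapped[OF ch left(2)] X(4) by (simp add: swapped_twice)
    ultimately show "?\<psi> X \<in> ?I" using left by (simp add: X(1))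
  qed auto
  finally show ?thesis by simp
qed

text \<open>All pairs obtained from one left pair have congruent words, so each left pair counts
  with the number of admissible \<open>R\<close>: subsets of size q - a among its p + q - 2a
  unbalanced components.\<close>

lemma congH_ncmul_eP_eP:
  "congH lt (ncmul (eP lt (int p)) (eP lt (int q)))
    (\<lambda>w. \<Sum>a\<le>(p + q) div 2. int (binomial_diff (p + q - 2 * a) q a)
        * (\<Sum>X\<in>left_pairs_of (p + q) a. mono (pair_word X) w))"
proof -
  let ?n = "p + q"
  let ?L = "{Y. Y \<in> left_pairs \<and> card (fst Y) + card (snd Y) = ?n}"
  let ?RR = "\<lambda>Y. {R. R \<subseteq> left_dominant (fst Y) (snd Y) \<and> card (snd Y) + card R = q}"
  let ?c = "\<lambda>a. int (binomial_diff (?n - 2 * a) q a)"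
  have "congH lt (ncmul (eP lt (int p)) (eP lt (int q))) (\<lambda>w. \<Sum>Y\<in>?L. \<Sum>R\<in>?RR Y. mono (pair_word Y) w)"
    unfolding ncmul_eP_eP sum_chain_pairs_reindex
  proof (intro congH_sum)
    fix Y R assume "Y \<in> ?L" "R \<in> ?RR Y"
    then show "congH lt (mono (pair_word (swapped (fst Y) (snd Y) R, swapped (snd Y) (fst Y) R)))
        (mono (pair_word Y))"
      using weq_pair_word_swapped[of "fst Y" "snd Y" R] by (simp add: weq_def left_pairs_def split_beta)
  qed
  moreover have "(\<lambda>w. \<Sum>Y\<in>?L. \<Sum>R\<in>?RR Y. mono (pair_word Y) w) =
      (\<lambda>w. \<Sum>a\<le>?n div 2. ?c a * (\<Sum>X\<in>left_pairs_of ?n a. mono (pair_word X) w))"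
  proof
    fix w
    have count: "card (?RR Y) = binomial_diff (?n - 2 * card (snd Y)) q (card (snd Y))" if "Y \<in> ?L" for Y
    proof (cases "q < card (snd Y)")
      case True
      then have "?RR Y = {}" by auto
      then show ?thesis using True by (simp add: binomial_diff_def)
    next
      case False
      then have "?RR Y = {R. R \<subseteq> left_dominant (fst Y) (snd Y) \<and> card R = q - card (snd Y)}" by auto
      moreover have "card (left_dominant (fst Y) (snd Y)) = ?n - 2 * card (snd Y)"
        using that card_left_dominant[of "fst Y" "snd Y"] by (cases Y) auto
      ultimately show ?thesis using False by (simp add: binomial_diff_def n_subsets)
    qed
    have "card (snd Y) \<le> ?n div 2" if "Y \<in> ?L" for Y
      using that card_left_dominant[of "fst Y" "snd Y"] by (cases Y) auto
    then have sub: "(\<lambda>Y. card (snd Y)) ` ?L \<subseteq> {..?n div 2}" by auto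
    have "(\<Sum>Y\<in>?L. \<Sum>R\<in>?RR Y. mono (pair_word Y) w) = (\<Sum>Y\<in>?L. ?c (card (snd Y)) * mono (pair_word Y) w)"
      by (rule sum.cong) (simp_all add: count)
    also have "\<dots> = (\<Sum>a\<le>?n div 2. \<Sum>Y | Y \<in> ?L \<and> card (snd Y) = a. ?c (card (snd Y)) * mono (pair_word Y) w)"
      using sum.group[OF _ _ sub, of "\<lambda>Y. ?c (card (snd Y)) * mono (pair_word Y) w"] by simp
    also have "\<dots> = (\<Sum>a\<le>?n div 2. ?c a * (\<Sum>X\<in>left_pairs_of ?n a. mono (pair_word X) w))"
      unfolding sum_distrib_left by (intro sum.cong) (auto simp: left_pairs_of_def)
    finally show "(\<Sum>Y\<in>?L. \<Sum>R\<in>?RR Y. mono (pair_word Y) w) =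
      (\<Sum>a\<le>?n div 2. ?c a * (\<Sum>X\<in>left_pairs_of ?n a. mono (pair_word X) w))" .
  qed
  ultimately show ?thesis by simp
qed

section \<open>Left tableaux as left pairs of chains\<close>

fun untag :: "'a + 'a \<Rightarrow> 'a" where
  "untag (Inl x) = x"
| "untag (Inr x) = x"

lemma inc_edges_component:
  assumes "(v, z) \<in> (inc_edges lt C D)\<^sup>*"
  shows "untag z \<in> component (C \<union> D) (untag v)"
  using assms
proof (induction rule: rtrancl_induct)
  case (step y z)
  then have "untag y \<in> C \<union> D" "untag z \<in> C \<union> D" "sim lt (untag y) (untag z)"
    using sim_sym by (auto simp: inc_edges_def)
  then show ?case using step.IH component_step by blast
qed (rule component_self)

text \<open>A path in \<open>C \<union> D\<close> lifts to the tagged graph: a step between the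
  chains is an edge, and a step inside one chain does not move. The two copies of an element of both
  chains are adjacent because \<open>sim\<close> is reflexive.\<close>

lemma component_inc_edges:
  assumes C: "is_chain lt C" and D: "is_chain lt D"
    and v: "v \<in> Inl ` C \<union> Inr ` D" and y: "y \<in> component (C \<union> D) (untag v)"
    and z: "z \<in> Inl ` C \<union> Inr ` D" "untag z = y"
  shows "(v, z) \<in> (inc_edges lt C D)\<^sup>*"
  using y z unfolding component_def mem_Collect_eq
proof (induction arbitrary: z rule: rtrancl_induct)
  case base
  then have "v = z \<or> (v, z) \<in> inc_edges lt C D"
    using v sim_refl by (auto simp: inc_edges_def)
  then show ?case by auto
next
  case (step x y)
  then have xy: "x \<in> C \<union> D" "y \<in> C \<union> D" "sim lt x y" by auto
  from step.prems consider "z = Inl y" "y \<in> C" | "z = Inr y" "y \<in> D" by auto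
  then show ?case
  proof cases
    case 1
    show ?thesis
    proof (cases "x \<in> D")
      case True
      then have "(v, Inr x) \<in> (inc_edges lt C D)\<^sup>*" by (intro step.IH) auto
      moreover have "(Inr x, z) \<in> inc_edges lt C D"
        using 1 True xy(3) sim_sym by (auto simp: inc_edges_def)
      ultimately show ?thesis by (rule rtrancl_into_rtrancl)
    next
      case False
      then have "x = y" using xy 1 is_chain_sim_eq[OF C] by blast
      then show ?thesis using step.IH step.prems by blast
    qed
  next
    case 2
    show ?thesis
    proof (cases "x \<in> C")
      case True
      then have "(v, Inl x) \<in> (inc_edges lt C D)\<^sup>*" by (intro step.IH) auto
      moreover have "(Inl x, z) \<in> inc_edges lt C D"
        using 2 True xy(3) by (auto simp: inc_edges_def)
      ultimately show ?thesis by (rule rtrancl_into_rtrancl)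
    next
      case False
      then have "x = y" using xy 2 is_chain_sim_eq[OF D] by blast
      then show ?thesis using step.IH step.prems by blast
    qed
  qed
qed

lemma ladders_eq_components:
  assumes "is_chain lt C" "is_chain lt D"
  shows "ladders lt C D = (\<lambda>K. Inl ` (C \<inter> K) \<union> Inr ` (D \<inter> K)) ` components (C \<union> D)"
proof -
  have *: "{x \<in> Inl ` C \<union> Inr ` D. (v, x) \<in> (inc_edges lt C D)\<^sup>*} =
      Inl ` (C \<inter> component (C \<union> D) (untag v)) \<union> Inr ` (D \<inter> component (C \<union> D) (untag v))" (is "?A = ?B")
    if "v \<in> Inl ` C \<union> Inr ` D" for v
  proof
    show "?A \<subseteq> ?B" using inc_edges_component[of v _ C D] by fastforce
    show "?B \<subseteq> ?A" using component_inc_edges[OF assms that] by fastforce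
  qed
  have "untag ` (Inl ` C \<union> Inr ` D) = C \<union> D" by (simp add: image_Un image_image)
  then have "components (C \<union> D) = (\<lambda>v. component (C \<union> D) (untag v)) ` (Inl ` C \<union> Inr ` D)"
    unfolding components_def by (metis image_image)
  then show ?thesis unfolding ladders_def by (simp only: image_image) (rule image_cong[OF refl *])
qed

lemma left_pairs_iff_ladders:
  assumes "is_chain lt C" "is_chain lt D"
  shows "(C, D) \<in> left_pairs \<longleftrightarrow> (\<forall>L\<in>ladders lt C D. balanced C D L \<or> left_unbalanced C D L)"
proof -
  have "balanced C D L \<or> left_unbalanced C D L \<longleftrightarrow> card (D \<inter> K) \<le> card (C \<inter> K)"
    if "L = Inl ` (C \<inter> K) \<union> Inr ` (D \<inter> K)" for K L
  proof -
    have "L \<inter> Inl ` C = Inl ` (C \<inter> K)" "L \<inter> Inr ` D = Inr ` (D \<inter> K)" using that by auto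
    then show ?thesis unfolding balanced_def left_unbalanced_def
      by (auto simp: card_image)
  qed
  then show ?thesis
    using assms unfolding ladders_eq_components[OF assms]
    by (auto simp: left_pairs_def chain_pairs_def left_dominant_def Un_commute not_less)
qed

text \<open>Translates row indices into the heights compared in \<open>left_heights\<close>.\<close>

lemma sorted_wrt_height:
  assumes "sorted_wrt lt xs" "r < length xs"
  shows "card {y \<in> set xs. lt y (xs ! r)} = r"
proof -
  have "{y \<in> set xs. lt y (xs ! r)} = (!) xs ` {..<r}"
  proof
    show "{y \<in> set xs. lt y (xs ! r)} \<subseteq> (!) xs ` {..<r}"
    proof
      fix y assume "y \<in> {y \<in> set xs. lt y (xs ! r)}"
      then obtain i where i: "i < length xs" "y = xs ! i" "lt (xs ! i) (xs ! r)"
        by (auto simp: in_set_conv_nth)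
      have "i < r"
      proof (rule ccontr)
        assume "\<not> i < r"
        then have "r = i \<or> lt (xs ! r) (xs ! i)"
          using sorted_wrt_nth_less[OF assms(1), of r i] i(1) by (metis linorder_neqE_nat)
        then show False using i(3) lt_irrefl lt_asym by metis
      qed
      then show "y \<in> (!) xs ` {..<r}" using i(2) by blast
    qed
    show "(!) xs ` {..<r} \<subseteq> {y \<in> set xs. lt y (xs ! r)}"
      using assms sorted_wrt_nth_less[OF assms(1)] by auto
  qed
  moreover have "inj_on ((!) xs) {..<r}"
    using sorted_wrt_lt_distinct[OF assms(1)] assms(2) by (auto simp: inj_on_def nth_eq_iff_index_eq)
  ultimately show ?thesis by (simp add: card_image)
qed

text \<open>The row condition is thus automatic, and a left pair is a left tableau once its chains
  are written as columns.\<close>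

lemma left_pairs_rows:
  assumes "(C, D) \<in> left_pairs" "r < card D"
  shows "\<not> lt (asc D ! r) (asc C ! r)"
proof
  assume less: "lt (asc D ! r) (asc C ! r)"
  have C: "is_chain lt C" and D: "is_chain lt D"
    using assms(1) by (auto simp: left_pairs_def chain_pairs_def)
  have len: "r < length (asc D)" "r < length (asc C)"
    using assms card_left_dominant[OF assms(1)] by (simp_all add: length_asc C D)
  have "asc C ! r \<in> C" "asc D ! r \<in> D" using len asc[OF C] asc[OF D] nth_mem by blast+
  from left_heights[OF C D left_pairs_le[OF assms(1)] this less]
  show False
    using sorted_wrt_height[OF asc(1)[OF C] len(2)] sorted_wrt_height[OF asc(1)[OF D] len(1)]
    by (simp add: asc C D)
qed

end

section \<open>The determinants for shapes with at most two columns\<close>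

lemma part1_two_col: "2 * a \<le> n \<Longrightarrow> part1 (two_col n a) = (if n = 0 then 0 else if a = 0 then 1 else 2)"
  by (cases a) (auto simp: two_col_def part1_def)

lemma conj_part_two_col:
  assumes "2 * a \<le> n"
  shows "conj_part (two_col n a) (Suc 0) = n - a" "conj_part (two_col n a) (Suc (Suc 0)) = a"
  using assms by (auto simp: two_col_def conj_part_def)

lemma eP_0: "eP lt 0 = mono []"
  by (auto simp: eP_def mono_def)

lemma ncmul_mono_Nil_right: "ncmul f (mono []) = f"
  by (simp add: ncmul_mono_right)

lemma JP_two_col_0: "JP lt (two_col n 0) = eP lt (int n)"
proof (cases "n = 0")
  case True
  then show ?thesis by (auto simp: JP_def part1_two_col ncprod_def eP_def mono_def)
next
  case False
  then show ?thesis
    using conj_part_two_col[of 0 n]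
    by (simp add: JP_def part1_two_col ncprod_def ncmul_mono_Nil_right)
qed

text \<open>The index n - c + 1 is written \<open>n - (c - 1)\<close>, so that both products have
  the form e_(n-q) e_q.\<close>

lemma JP_two_col_pos:
  assumes "2 * c \<le> n" "c > 0"
  shows "JP lt (two_col n c) = (\<lambda>w. ncmul (eP lt (int (n - c))) (eP lt (int c)) w
    + (-1) * ncmul (eP lt (int (n - (c - 1)))) (eP lt (int (c - 1))) w)"
proof -
  have perms: "{\<pi>. \<pi> permutes {1..2::nat}} = {id, transpose 1 2}"
  proof -
    have "{1..2} = {1, 2::nat}" by auto
    then show ?thesis by (auto simp: permutes_doubleton_iff)
  qed
  have ne: "id \<noteq> transpose 1 (2::nat)" by (auto simp: fun_eq_iff transpose_def)
  let ?conj = "conj_part (two_col n c)"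
  let ?P = "\<lambda>\<pi>. ncprod (map (\<lambda>i. eP lt (int (?conj i) + int (\<pi> i) - int i)) [1..<2 + 1])"
  have upt: "[1..<2 + 1] = [1, 2::nat]" by (simp add: upt_rec)
  have conj: "?conj 1 = n - c" "?conj 2 = c"
    using conj_part_two_col[OF assms(1)] by (simp_all add: numeral_2_eq_2)
  have args: "int (?conj 1) + int (id 1) - int 1 = int (n - c)" "int (?conj 2) + int (id 2) - int 2 = int c"
    "int (?conj 1) + int (transpose 1 (2::nat) 1) - int 1 = int (n - (c - 1))"
    "int (?conj 2) + int (transpose 1 (2::nat) 2) - int 2 = int (c - 1)"
    unfolding conj using assms by simp_all
  have P: "?P \<pi> = ncmul (eP lt (int (?conj 1) + int (\<pi> 1) - int 1)) (eP lt (int (?conj 2) + int (\<pi> 2) - int 2))" for \<pi>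
    unfolding upt by (simp add: ncprod_def ncmul_mono_Nil_right)
  have "part1 (two_col n c) = 2" using assms part1_two_col[of c n] by simp
  then have "JP lt (two_col n c) = (\<lambda>w. \<Sum>\<pi>\<in>{id, transpose 1 2}. sign \<pi> * ?P \<pi> w)"
    unfolding JP_def by (simp only: perms)
  also have "\<dots> = (\<lambda>w. ?P id w + (-1) * ?P (transpose 1 2) w)"
    using ne by (simp add: sign_swap_id)
  finally show ?thesis unfolding P args .
qed

text \<open>A tableau lists exactly \<open>part1\<close> columns, so empty columns have to be left
  out.\<close>

definition two_columns :: "nat \<Rightarrow> nat \<Rightarrow> 'a list \<Rightarrow> 'a list \<Rightarrow> 'a list list" where
  "two_columns n a xs ys = (if n = 0 then [] else if a = 0 then [xs] else [xs, ys])"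

lemma two_columns:
  assumes "2 * a \<le> n" "length xs = n - a" "length ys = a"
  shows "col1 (two_columns n a xs ys) = xs" "col2 (two_columns n a xs ys) = ys"
    "colword (two_columns n a xs ys) = rev xs @ rev ys" "length (two_columns n a xs ys) \<le> 2"
  using assms by (auto simp: two_columns_def col1_def col2_def colword_def)

lemma ptableau_two_col_iff:
  assumes "2 * a \<le> n"
  shows "ptableau lt (two_col n a) T \<longleftrightarrow>
    (\<exists>xs ys. T = two_columns n a xs ys \<and> length xs = n - a \<and> length ys = a
      \<and> sorted_wrt lt xs \<and> sorted_wrt lt ys \<and> (\<forall>r<a. \<not> lt (ys ! r) (xs ! r)))"
proof -
  consider "n = 0" "a = 0" | "n > 0" "a = 0" | "n > 0" "a > 0" using assms by fastforce
  then show ?thesis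
  proof cases
    case 1
    then show ?thesis using assms by (auto simp: ptableau_def part1_two_col two_columns_def)
  next
    case 2
    have "ptableau lt (two_col n a) T \<longleftrightarrow> (\<exists>xs. T = [xs] \<and> length xs = n \<and> sorted_wrt lt xs)"
      using 2 conj_part_two_col[OF assms]
      by (auto simp: ptableau_def part1_two_col length_Suc_conv)
    then show ?thesis using 2 by (auto simp: two_columns_def)
  next
    case 3
    have "ptableau lt (two_col n a) T \<longleftrightarrow> (\<exists>xs ys. T = [xs, ys] \<and> length xs = n - a \<and> length ys = a
      \<and> sorted_wrt lt xs \<and> sorted_wrt lt ys \<and> (\<forall>r<a. \<not> lt (ys ! r) (xs ! r)))"
    proof -
      have "ptableau lt (two_col n a) T \<Longrightarrow> \<exists>xs ys. T = [xs, ys]"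
        using 3 assms by (auto simp: ptableau_def part1_two_col length_Suc_conv numeral_2_eq_2)
      moreover have "ptableau lt (two_col n a) [xs, ys] \<longleftrightarrow> length xs = n - a \<and> length ys = a
          \<and> sorted_wrt lt xs \<and> sorted_wrt lt ys \<and> (\<forall>r<a. \<not> lt (ys ! r) (xs ! r))" for xs ys
        using 3 assms conj_part_two_col[OF assms]
        by (auto simp: ptableau_def part1_two_col numeral_2_eq_2 less_Suc_eq all_conj_distrib)
      ultimately show ?thesis by blast
    qed
    then show ?thesis using 3 by (simp add: two_columns_def)
  qed
qed

context finite_31_free_poset
begin

lemma LTsum_two_col:
  assumes "2 * a \<le> n"
  shows "LTsum lt (two_col n a) = (\<lambda>w. \<Sum>X\<in>left_pairs_of n a. mono (pair_word X) w)"
proof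
  fix w
  let ?i = "\<lambda>X. two_columns n a (asc (fst X)) (asc (snd X))"
  let ?j = "\<lambda>T. (set (col1 T), set (col2 T))"
  have T: "?i (?j T) = T \<and> ?j T \<in> left_pairs_of n a \<and> pair_word (?j T) = colword T"
    if LT: "T \<in> LT lt (two_col n a)" for T
  proof -
    obtain xs ys where xy: "T = two_columns n a xs ys" "length xs = n - a" "length ys = a"
      "sorted_wrt lt xs" "sorted_wrt lt ys"
      using LT unfolding LT_def left_ptableau_def ptableau_two_col_iff[OF assms] by blast
    note cols = two_columns[OF assms xy(2,3)]
    have "(set xs, set ys) \<in> left_pairs"
      using LT left_pairs_iff_ladders[OF sorted_wrt_lt_is_chain[OF xy(4)] sorted_wrt_lt_is_chain[OF xy(5)]]
      by (simp add: LT_def left_ptableau_def xy(1) cols)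
    moreover have "card (set xs) = n - a" "card (set ys) = a"
      using xy distinct_card[OF sorted_wrt_lt_distinct] by metis+
    ultimately show ?thesis
      using assms by (simp add: xy(1) cols left_pairs_of_def pair_word_def desc_def asc_set xy(4,5))
  qed
  have X: "?i X \<in> LT lt (two_col n a) \<and> ?j (?i X) = X" if X: "X \<in> left_pairs_of n a" for X
  proof -
    obtain C D where CD: "X = (C, D)" by fastforce
    have left: "(C, D) \<in> left_pairs" and card: "card C = n - a" "card D = a"
      using X by (auto simp: CD left_pairs_of_def)
    have C: "is_chain lt C" and D: "is_chain lt D"
      using left by (auto simp: left_pairs_def chain_pairs_def)
    have len: "length (asc C) = n - a" "length (asc D) = a" using card C D by (simp_all add: length_asc)
    note cols = two_columns[OF assms len]
    have "\<forall>r<a. \<not> lt (asc D ! r) (asc C ! r)" using left_pairs_rows[OF left] card by simp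
    then have "ptableau lt (two_col n a) (two_columns n a (asc C) (asc D))"
      unfolding ptableau_two_col_iff[OF assms] using len asc(1)[OF C] asc(1)[OF D] by blast
    then show ?thesis
      using left left_pairs_iff_ladders[OF C D]
      by (simp add: CD LT_def left_ptableau_def cols asc(2) C D)
  qed
  show "LTsum lt (two_col n a) w = (\<Sum>X\<in>left_pairs_of n a. mono (pair_word X) w)"
    unfolding LTsum_def
  proof (rule sum.reindex_bij_witness[where i = ?i and j = ?j])
    fix T assume "T \<in> LT lt (two_col n a)"
    from T[OF this] show "?i (?j T) = T" "?j T \<in> left_pairs_of n a"
      "mono (pair_word (?j T)) w = mono (colword T) w" by simp_all
  next
    fix Y assume "Y \<in> left_pairs_of n a"
    from X[OF this] show "?j (?i Y) = Y" "?i Y \<in> LT lt (two_col n a)" by simp_all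
  qed
qed

text \<open>For \<open>c = 0\<close> the subtracted product would contain e_(-1) = 0; the
  conditional replaces it because \<open>c - 1\<close> truncates to 0.\<close>

lemma congH_JP_two_col:
  assumes "2 * c \<le> n"
  shows "congH lt (JP lt (two_col n c))
    (\<lambda>w. \<Sum>a\<le>n div 2. (int (binomial_diff (n - 2 * a) c a)
        - (if c = 0 then 0 else int (binomial_diff (n - 2 * a) (c - 1) a))) * LTsum lt (two_col n a) w)"
proof -
  define F where "F q = (\<lambda>w. \<Sum>a\<le>n div 2. int (binomial_diff (n - 2 * a) q a) * LTsum lt (two_col n a) w)" for q
  have F: "congH lt (ncmul (eP lt (int (n - q))) (eP lt (int q))) (F q)" if "q \<le> n" for q
  proof -
    have "F q = (\<lambda>w. \<Sum>a\<le>n div 2. int (binomial_diff (n - 2 * a) q a)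
        * (\<Sum>X\<in>left_pairs_of n a. mono (pair_word X) w))"
      unfolding F_def by (intro ext sum.cong) (auto simp: LTsum_two_col)
    then show ?thesis using congH_ncmul_eP_eP[of "n - q" q] that by simp
  qed
  show ?thesis
  proof (cases "c = 0")
    case True
    have "JP lt (two_col n c) = ncmul (eP lt (int (n - 0))) (eP lt (int 0))"
      using JP_two_col_0[of lt n] True by (simp add: eP_0 ncmul_mono_Nil_right)
    then show ?thesis using F[of 0] True unfolding F_def by simp
  next
    case False
    have "JP lt (two_col n c) = (\<lambda>w. ncmul (eP lt (int (n - c))) (eP lt (int c)) w
        + (-1) * ncmul (eP lt (int (n - (c - 1)))) (eP lt (int (c - 1))) w)"
      using JP_two_col_pos[OF assms] False by simp
    moreover have "congH lt \<dots> (\<lambda>w. F c w + (-1) * F (c - 1) w)"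
      using assms by (intro congH_add congH_scale F) auto
    ultimately show ?thesis using False unfolding F_def
      by (simp add: sum_negf[symmetric] sum.distrib[symmetric] left_diff_distrib)
  qed
qed

end

section \<open>The inverse Kostka matrix\<close>

definition unitriangular_on :: "'b set \<Rightarrow> ('b \<Rightarrow> 'b \<Rightarrow> bool) \<Rightarrow> ('b \<Rightarrow> 'b \<Rightarrow> int) \<Rightarrow> bool" where
  "unitriangular_on S R K \<longleftrightarrow> (\<forall>x\<in>S. K x x = 1) \<and> (\<forall>x\<in>S. \<forall>y\<in>S. K x y \<noteq> 0 \<longrightarrow> R y x)"

locale finite_order_on =
  fixes S :: "'b set" and R :: "'b \<Rightarrow> 'b \<Rightarrow> bool"
  assumes fin: "finite S"
    and refl: "x \<in> S \<Longrightarrow> R x x"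
    and trans: "x \<in> S \<Longrightarrow> y \<in> S \<Longrightarrow> z \<in> S \<Longrightarrow> R x y \<Longrightarrow> R y z \<Longrightarrow> R x z"
    and antisym: "x \<in> S \<Longrightarrow> y \<in> S \<Longrightarrow> R x y \<Longrightarrow> R y x \<Longrightarrow> x = y"
begin

lemma card_below_less:
  assumes "x \<in> S" "y \<in> S" "R y x" "y \<noteq> x"
  shows "card {z \<in> S. R z y} < card {z \<in> S. R z x}"
proof (rule psubset_card_mono)
  have "x \<notin> {z \<in> S. R z y}" "x \<in> {z \<in> S. R z x}" using assms refl antisym by blast+
  moreover have "{z \<in> S. R z y} \<subseteq> {z \<in> S. R z x}" using assms trans by blast
  ultimately show "{z \<in> S. R z y} \<subset> {z \<in> S. R z x}" by blast
qed (simp add: fin)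

lemma card_above_less:
  assumes "x \<in> S" "y \<in> S" "R x y" "y \<noteq> x"
  shows "card {z \<in> S. R y z} < card {z \<in> S. R x z}"
proof (rule psubset_card_mono)
  have "x \<notin> {z \<in> S. R y z}" "x \<in> {z \<in> S. R x z}" using assms refl antisym by blast+
  moreover have "{z \<in> S. R y z} \<subseteq> {z \<in> S. R x z}" using assms trans by blast
  ultimately show "{z \<in> S. R y z} \<subset> {z \<in> S. R x z}" by blast
qed (simp add: fin)

lemma unitriangular_row_inverse:
  assumes K: "unitriangular_on S R K" and "x \<in> S"
  shows "\<exists>v. (\<forall>y. v y \<noteq> 0 \<longrightarrow> y \<in> S \<and> R y x) \<and> (\<forall>y\<in>S. (\<Sum>z\<in>S. v z * K z y) = (if x = y then 1 else 0))"
  using assms(2)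
proof (induction "card {z \<in> S. R z x}" arbitrary: x rule: less_induct)
  case less
  let ?B = "{y \<in> S. y \<noteq> x \<and> R y x}"
  have "\<exists>v. (\<forall>z. v z \<noteq> 0 \<longrightarrow> z \<in> S \<and> R z y) \<and> (\<forall>t\<in>S. (\<Sum>z\<in>S. v z * K z t) = (if y = t then 1 else 0))"
    if "y \<in> ?B" for y
  proof (rule less.hyps)
    show "card {z \<in> S. R z y} < card {z \<in> S. R z x}" using that less.prems by (intro card_below_less) auto
    show "y \<in> S" using that by simp
  qed
  then obtain V where V: "\<And>y z. y \<in> ?B \<Longrightarrow> V y z \<noteq> 0 \<Longrightarrow> z \<in> S \<and> R z y"
    "\<And>y t. y \<in> ?B \<Longrightarrow> t \<in> S \<Longrightarrow> (\<Sum>z\<in>S. V y z * K z t) = (if y = t then 1 else 0)"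
    using bchoice[of ?B "\<lambda>y v. (\<forall>z. v z \<noteq> 0 \<longrightarrow> z \<in> S \<and> R z y) \<and> (\<forall>t\<in>S. (\<Sum>z\<in>S. v z * K z t) = (if y = t then 1 else 0))"]
    by blast
  \<comment> \<open>Substitution: row x of \<open>K\<close> is the unit vector at x plus multiples
    \<open>K x y\<close> of the unit vectors at smaller y, and \<open>V y\<close> times
    \<open>K\<close> is the unit vector at y.\<close>
  let ?v = "\<lambda>z. (if z = x then 1 else 0) - (\<Sum>y\<in>?B. K x y * V y z)"
  have "y \<in> S \<and> R y x" if "?v y \<noteq> 0" for y
  proof (cases "y = x")
    case True
    then show ?thesis using less.prems refl by blast
  next
    case False
    then have "(\<Sum>u\<in>?B. K x u * V u y) \<noteq> 0" using that by simp
    then obtain u where "u \<in> ?B" "K x u * V u y \<noteq> 0" by (rule sum.not_neutral_contains_not_neutral)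
    then show ?thesis using V(1)[of u y] trans[of y u x] less.prems by auto
  qed
  moreover have "(\<Sum>z\<in>S. ?v z * K z t) = (if x = t then 1 else 0)" if t: "t \<in> S" for t
  proof -
    have "(\<Sum>z\<in>S. ?v z * K z t) = (\<Sum>z\<in>S. (if z = x then K z t else 0)) - (\<Sum>z\<in>S. \<Sum>y\<in>?B. K x y * V y z * K z t)"
      unfolding sum_subtractf[symmetric] by (rule sum.cong) (auto simp: left_diff_distrib sum_distrib_right)
    also have "(\<Sum>z\<in>S. (if z = x then K z t else 0)) = K x t"
      using less.prems fin by simp
    also have "(\<Sum>z\<in>S. \<Sum>y\<in>?B. K x y * V y z * K z t) = (\<Sum>y\<in>?B. K x y * (\<Sum>z\<in>S. V y z * K z t))"
      by (subst sum.swap) (simp add: sum_distrib_left mult.assoc)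
    also have "\<dots> = (\<Sum>y\<in>?B. if y = t then K x y else 0)"
      using V(2) t by (intro sum.cong) auto
    also have "\<dots> = (if t \<in> ?B then K x t else 0)" using fin by simp
    also have "K x t - \<dots> = (if x = t then 1 else 0)"
      using K t less.prems unfolding unitriangular_on_def by auto
    finally show ?thesis .
  qed
  ultimately show ?case by (intro exI[of _ ?v]) blast
qed

text \<open>Induction from the top: column x of \<open>K\<close> lives on indices above x, and at
  those strictly above \<open>v\<close> is already known to vanish.\<close>

lemma unitriangular_null:
  assumes K: "unitriangular_on S R K" and v: "\<And>y. y \<in> S \<Longrightarrow> (\<Sum>z\<in>S. v z * K z y) = 0" and "x \<in> S"
  shows "v x = 0"
  using assms(3)
proof (induction "card {z \<in> S. R x z}" arbitrary: x rule: less_induct)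
  case less
  have "v z * K z x = (if z = x then v x else 0)" if "z \<in> S" for z
    using that less.prems less.hyps[OF card_above_less[of x z]] K unfolding unitriangular_on_def by auto
  then have "(\<Sum>z\<in>S. v z * K z x) = (\<Sum>z\<in>S. if z = x then v x else 0)" by (rule sum.cong[OF HOL.refl])
  also have "\<dots> = v x" using fin less.prems by simp
  finally show ?case using v[OF less.prems] by simp
qed

text \<open>\<open>is_inv\<close> repeats the description behind \<open>kostka_inv\<close>.
  Vanishing outside \<open>S\<close> makes the inverse unique as a total function, so the definite
  description denotes it.\<close>

lemma unitriangular_left_inverse:
  assumes K: "unitriangular_on S R K"
  defines "is_inv M \<equiv> (\<forall>x y. M x y \<noteq> 0 \<longrightarrow> x \<in> S \<and> y \<in> S) \<and>
    (\<forall>x\<in>S. \<forall>y\<in>S. (\<Sum>z\<in>S. M x z * K z y) = (if x = y then (1::int) else 0))"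
  shows "is_inv (The is_inv)" and "The is_inv x y \<noteq> 0 \<Longrightarrow> R y x"
proof -
  obtain V where V: "\<And>x y. x \<in> S \<Longrightarrow> V x y \<noteq> 0 \<Longrightarrow> y \<in> S \<and> R y x"
    "\<And>x y. x \<in> S \<Longrightarrow> y \<in> S \<Longrightarrow> (\<Sum>z\<in>S. V x z * K z y) = (if x = y then 1 else 0)"
    using bchoice[of S "\<lambda>x v. (\<forall>y. v y \<noteq> 0 \<longrightarrow> y \<in> S \<and> R y x) \<and> (\<forall>y\<in>S. (\<Sum>z\<in>S. v z * K z y) = (if x = y then 1 else 0))"]
      unitriangular_row_inverse[OF K] by blast
  let ?M = "\<lambda>x y. if x \<in> S then V x y else 0"
  have M: "is_inv ?M"
    unfolding is_inv_def
  proof (intro conjI allI impI ballI)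
    fix x y assume "?M x y \<noteq> 0"
    then show "x \<in> S" "y \<in> S" using V(1)[of x y] by (auto split: if_splits)
  next
    fix x y assume "x \<in> S" "y \<in> S"
    then show "(\<Sum>z\<in>S. ?M x z * K z y) = (if x = y then 1 else 0)" using V(2)[of x y] by simp
  qed
  have supp: "x \<in> S \<and> y \<in> S" if "is_inv M" "M x y \<noteq> 0" for M x y
    using that unfolding is_inv_def by blast
  have row: "(\<Sum>z\<in>S. M x z * K z y) = (if x = y then 1 else 0)" if "is_inv M" "x \<in> S" "y \<in> S" for M x y
    using that unfolding is_inv_def by blast
  have unique: "M = ?M" if "is_inv M" for M
  proof (intro ext)
    fix x y
    have "M x y - ?M x y = 0" if "x \<in> S" "y \<in> S"
    proof (rule unitriangular_null[OF K])
      fix t assume "t \<in> S"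
      then show "(\<Sum>z\<in>S. (M x z - ?M x z) * K z t) = 0"
        using row[OF \<open>is_inv M\<close> \<open>x \<in> S\<close>] row[OF M \<open>x \<in> S\<close>]
        unfolding left_diff_distrib sum_subtractf by simp
    qed (rule that)
    moreover have "M x y = 0" "?M x y = 0" if "\<not> (x \<in> S \<and> y \<in> S)"
      using that supp[OF \<open>is_inv M\<close>] supp[OF M] by blast+
    ultimately show "M x y = ?M x y" by (cases "x \<in> S \<and> y \<in> S") simp_all
  qed
  have The: "The is_inv = ?M" by (rule the_equality) (rule M, rule unique)
  show "is_inv (The is_inv)" unfolding The by (rule M)
  show "The is_inv x y \<noteq> 0 \<Longrightarrow> R y x" unfolding The using V(1)[of x y] by (simp split: if_splits)
qed

end

section \<open>Dominance order and triangularity of the Kostka matrix\<close>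

definition dominated :: "nat list \<Rightarrow> nat list \<Rightarrow> bool" where
  "dominated \<mu> \<nu> \<longleftrightarrow> (\<forall>i. sum_list (take i \<mu>) \<le> sum_list (take i \<nu>))"

lemma finite_partitions: "finite (partitions n)"
proof (rule finite_subset)
  show "partitions n \<subseteq> {xs. set xs \<subseteq> {..n} \<and> length xs \<le> n}"
  proof
    fix xs assume "xs \<in> partitions n"
    then have xs: "\<forall>p\<in>set xs. 0 < p" "sum_list xs = n" by (auto simp: partitions_def is_partition_def)
    have "length xs \<le> sum_list xs" using xs(1) by (induction xs) auto
    then show "xs \<in> {xs. set xs \<subseteq> {..n} \<and> length xs \<le> n}"
      using xs(2) member_le_sum_list[of _ xs] by auto
  qed
qed (simp add: finite_lists_length_le)

text \<open>Gives antisymmetry of dominance; positivity excludes trailing zeros, which partial sums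
  cannot see.\<close>

lemma partial_sums_inject:
  assumes "\<forall>p\<in>set \<mu>. 0 < p" "\<forall>p\<in>set \<nu>. 0 < p"
    and "\<And>i. sum_list (take i \<mu>) = sum_list (take i \<nu>)"
  shows "\<mu> = (\<nu> :: nat list)"
  using assms
proof (induction \<mu> arbitrary: \<nu>)
  case Nil
  have "sum_list (take 1 \<nu>) = 0" using Nil.prems(3)[of 1] by simp
  then show ?case using Nil.prems(2) by (cases \<nu>) auto
next
  case (Cons p \<mu>)
  obtain q \<nu>' where \<nu>: "\<nu> = q # \<nu>'"
    using Cons.prems(1) Cons.prems(3)[of 1] by (cases \<nu>) auto
  have "p = q" using Cons.prems(3)[of 1] \<nu> by simp
  moreover have "\<mu> = \<nu>'"
  proof (rule Cons.IH)
    show "sum_list (take i \<mu>) = sum_list (take i \<nu>')" for i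
      using Cons.prems(3)[of "Suc i"] \<nu> \<open>p = q\<close> by simp
  qed (use Cons.prems \<nu> in auto)
  ultimately show ?case using \<nu> by simp
qed

interpretation dominance: finite_order_on "partitions n" dominated for n
proof
  fix x y assume "x \<in> partitions n" "y \<in> partitions n" "dominated x y" "dominated y x"
  then show "x = y"
    by (intro partial_sums_inject) (auto simp: partitions_def is_partition_def dominated_def intro: antisym)
qed (auto simp: finite_partitions dominated_def intro: order_trans)

lemma finite_cells: "finite (cells la)"
proof (rule finite_subset)
  show "cells la \<subseteq> {..<length la} \<times> {..<sum_list la}"
    using elem_le_sum_list[of _ la] by (fastforce simp: cells_def)
qed simp

lemma card_cells_rows: "card {x \<in> cells la. fst x < i} = sum_list (take i la)"
proof -
  have "{x \<in> cells la. fst x < i} = (SIGMA r:{..<min i (length la)}. {..<la ! r})"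
    by (auto simp: cells_def)
  then have "card {x \<in> cells la. fst x < i} = (\<Sum>r<min i (length la). la ! r)" by simp
  also have "\<dots> = (\<Sum>r<length (take i la). take i la ! r)"
    by (rule sum.cong) auto
  finally show ?thesis by (simp add: sum_list_sum_nth atLeast0LessThan)
qed

lemma card_ssyt_entries:
  assumes "T \<in> ssyt la \<mu>"
  shows "card {x \<in> cells la. T x \<le> i} = sum_list (take i \<mu>)"
proof -
  let ?m = "min i (length \<mu>)"
  have ge: "1 \<le> T x" "T x \<le> length \<mu>" if "x \<in> cells la" for x using assms that by (auto simp: ssyt_def)
  have "{x \<in> cells la. T x \<le> i} = (\<Union>j\<in>{..<?m}. {x \<in> cells la. T x = Suc j})"
  proof
    show "{x \<in> cells la. T x \<le> i} \<subseteq> (\<Union>j\<in>{..<?m}. {x \<in> cells la. T x = Suc j})"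
    proof
      fix x assume x: "x \<in> {x \<in> cells la. T x \<le> i}"
      then have "T x - 1 < ?m" "T x = Suc (T x - 1)" using ge[of x] by auto
      then show "x \<in> (\<Union>j\<in>{..<?m}. {x \<in> cells la. T x = Suc j})" using x by blast
    qed
  qed auto
  then have "card {x \<in> cells la. T x \<le> i} = (\<Sum>j<?m. card {x \<in> cells la. T x = Suc j})"
    using finite_cells[of la] by (simp only:) (subst card_UN_disjoint; auto)
  also have "\<dots> = (\<Sum>r<length (take i \<mu>). take i \<mu> ! r)"
    using assms by (intro sum.cong) (auto simp: ssyt_def)
  finally show ?thesis by (simp add: sum_list_sum_nth atLeast0LessThan)
qed

lemma cells_above:
  assumes "is_partition la" "(Suc r, c) \<in> cells la"
  shows "(r, c) \<in> cells la"
  using assms sorted_wrt_nth_less[of "(\<ge>)" la r "Suc r"] by (auto simp: is_partition_def cells_def)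

lemma ssyt_row_less:
  assumes "is_partition la" "T \<in> ssyt la \<mu>" "(r, c) \<in> cells la"
  shows "r < T (r, c)"
  using assms(3)
proof (induction r)
  case 0
  then show ?case using assms(2) by (auto simp: ssyt_def Suc_le_eq)
next
  case (Suc r)
  then have "r < T (r, c)" using cells_above[OF assms(1)] by blast
  moreover have "T (r, c) < T (Suc r, c)" using assms(2) Suc.prems by (auto simp: ssyt_def)
  ultimately show ?case by linarith
qed

text \<open>Columns increase strictly from at least 1, so row r, counted from 0, has entries above
  r. Comparing the sizes of the two sets is dominance.\<close>

lemma ssyt_entries_subset_rows:
  assumes "is_partition la" "T \<in> ssyt la \<mu>"
  shows "{x \<in> cells la. T x \<le> i} \<subseteq> {x \<in> cells la. fst x < i}"
  using ssyt_row_less[OF assms] by fastforce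

lemma kostka_nonzero_dominated:
  assumes "is_partition la" "kostka la \<mu> \<noteq> 0"
  shows "dominated \<mu> la"
proof -
  obtain T where T: "T \<in> ssyt la \<mu>"
    using assms(2) unfolding kostka_def by fastforce
  have "sum_list (take i \<mu>) \<le> sum_list (take i la)" for i
  proof -
    have "card {x \<in> cells la. T x \<le> i} \<le> card {x \<in> cells la. fst x < i}"
      using finite_cells[of la] ssyt_entries_subset_rows[OF assms(1) T] by (intro card_mono) auto
    then show ?thesis by (simp add: card_ssyt_entries[OF T] card_cells_rows)
  qed
  then show ?thesis by (simp add: dominated_def)
qed

text \<open>When content equals shape, the inclusion of \<open>ssyt_entries_subset_rows\<close> is
  between sets of equal size, which forces every entry to be its row number.\<close>

lemma kostka_self:
  assumes "is_partition la"
  shows "kostka la la = 1"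
proof -
  let ?T = "\<lambda>x. if x \<in> cells la then Suc (fst x) else 0"
  have "?T \<in> ssyt la la"
  proof -
    have "card {x \<in> cells la. ?T x = i} = la ! (i - 1)" if i: "i \<in> {1..length la}" for i
    proof -
      have "{x \<in> cells la. ?T x = i} = Pair (i - 1) ` {..<la ! (i - 1)}"
        using i by (auto simp: cells_def)
      then show ?thesis by (simp add: card_image inj_on_def)
    qed
    then show ?thesis using cells_above[OF assms] by (auto simp: ssyt_def) (auto simp: cells_def)
  qed
  moreover have "T = ?T" if T: "T \<in> ssyt la la" for T
  proof
    fix x
    have rows: "{x \<in> cells la. T x \<le> i} = {x \<in> cells la. fst x < i}" for i
      using ssyt_entries_subset_rows[OF assms T, of i] finite_cells[of la] card_ssyt_entries[OF T, of i]
        card_cells_rows[of la i] by (intro card_subset_eq) auto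
    show "T x = ?T x"
    proof (cases "x \<in> cells la")
      case True
      then have "T x \<le> Suc (fst x)" "\<not> T x \<le> fst x" using rows[of "Suc (fst x)"] rows[of "fst x"] by auto
      then show ?thesis using True by simp
    next
      case False
      then have "T x = 0" using T unfolding ssyt_def by blast
      then show ?thesis using False by simp
    qed
  qed
  ultimately have "ssyt la la = {?T}" by blast
  then show ?thesis by (simp add: kostka_def)
qed

lemma unitriangular_kostka: "unitriangular_on (partitions n) dominated kostka"
  by (simp add: unitriangular_on_def partitions_def kostka_self kostka_nonzero_dominated)

lemma kostka_inv:
  assumes "la \<in> partitions n" "\<mu> \<in> partitions n"
  shows "(\<Sum>\<nu>\<in>partitions n. kostka_inv n la \<nu> * kostka \<nu> \<mu>) = (if la = \<mu> then 1 else 0)"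
    and "kostka_inv n la \<nu> \<noteq> 0 \<Longrightarrow> dominated \<nu> la"
proof -
  note left_inverse = dominance.unitriangular_left_inverse[OF unitriangular_kostka[of n], folded kostka_inv_def]
  show "(\<Sum>\<nu>\<in>partitions n. kostka_inv n la \<nu> * kostka \<nu> \<mu>) = (if la = \<mu> then 1 else 0)"
    using left_inverse(1) assms by simp
  show "kostka_inv n la \<nu> \<noteq> 0 \<Longrightarrow> dominated \<nu> la" by (rule left_inverse(2))
qed

section \<open>Two-column Kostka numbers\<close>

lemma finite_ssyt: "finite (ssyt la \<mu>)"
proof (rule finite_subset)
  show "ssyt la \<mu> \<subseteq> {T. \<forall>x. (x \<in> cells la \<longrightarrow> T x \<in> {..length \<mu>}) \<and> (x \<notin> cells la \<longrightarrow> T x = 0)}"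
    unfolding ssyt_def by blast
  show "finite {T. \<forall>x. (x \<in> cells la \<longrightarrow> T x \<in> {..length \<mu>}) \<and> (x \<notin> cells la \<longrightarrow> T x = 0)}"
    by (rule finite_set_of_finite_funs[OF finite_cells]) simp
qed

lemma ssytD:
  assumes "T \<in> ssyt la \<mu>"
  shows "x \<notin> cells la \<Longrightarrow> T x = 0" "x \<in> cells la \<Longrightarrow> 1 \<le> T x" "x \<in> cells la \<Longrightarrow> T x \<le> length \<mu>"
    "(r, Suc c) \<in> cells la \<Longrightarrow> T (r, c) \<le> T (r, Suc c)"
    "(Suc r, c) \<in> cells la \<Longrightarrow> T (r, c) < T (Suc r, c)"
    "1 \<le> i \<Longrightarrow> i \<le> length \<mu> \<Longrightarrow> card {x \<in> cells la. T x = i} = \<mu> ! (i - 1)"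
  using assms unfolding ssyt_def by (blast, blast, blast, blast, blast, simp)

lemma ssyt_le_length: "T \<in> ssyt la \<mu> \<Longrightarrow> T x \<le> length \<mu>"
  using ssytD(1,3)[of T la \<mu> x] by (cases "x \<in> cells la") auto

lemma ssyt_largest_unique:
  assumes "T \<in> ssyt la (\<mu> @ [1])"
  obtains x where "{y \<in> cells la. T y = Suc (length \<mu>)} = {x}"
proof -
  have "card {y \<in> cells la. T y = Suc (length \<mu>)} = 1"
    using ssytD(6)[OF assms, of "Suc (length \<mu>)"] by simp
  then show ?thesis using that by (auto simp: card_1_singleton_iff)
qed

text \<open>A final part 1 in the content means that the largest entry occurs once; at a corner its
  cell can be deleted or added without affecting the other inequalities.\<close>

lemma card_ssyt_corner:
  assumes cells: "cells la = insert (r0, c0) (cells la')" and notin: "(r0, c0) \<notin> cells la'"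
    and corner: "(r0, Suc c0) \<notin> cells la" "(Suc r0, c0) \<notin> cells la"
  shows "card {T \<in> ssyt la (\<mu> @ [1]). T (r0, c0) = Suc (length \<mu>)} = card (ssyt la' \<mu>)"
proof (rule bij_betw_same_card)
  let ?N = "Suc (length \<mu>)" and ?x = "(r0, c0)"
  \<comment> \<open>The deleted cell is reset to 0 because fillings are 0 outside their
    shape.\<close>
  let ?f = "\<lambda>T. T(?x := 0)" and ?g = "\<lambda>T. T(?x := ?N)"
  have f: "?f T \<in> ssyt la' \<mu>" if T: "T \<in> ssyt la (\<mu> @ [1])" and Tx: "T ?x = ?N" for T
  proof -
    obtain z where z: "{y \<in> cells la. T y = ?N} = {z}" using ssyt_largest_unique[OF T] .
    have uniq: "y = ?x" if "y \<in> cells la" "T y = ?N" for y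
    proof -
      have "y \<in> {z}" "?x \<in> {z}" unfolding z[symmetric] using that cells Tx by simp_all
      then show ?thesis by simp
    qed
    show ?thesis
      unfolding ssyt_def mem_Collect_eq
    proof (intro conjI allI ballI impI)
      show "?f T x = 0" if "x \<notin> cells la'" for x
        using that cells ssytD(1)[OF T] by auto
    next
      fix x assume x: "x \<in> cells la'"
      then have x': "x \<in> cells la" "x \<noteq> ?x" using cells notin by auto
      then show "1 \<le> ?f T x" using ssytD(2)[OF T] by simp
      have "T x \<noteq> ?N" using uniq[OF x'(1)] x'(2) by blast
      moreover have "T x \<le> ?N" using ssytD(3)[OF T x'(1)] by simp
      ultimately show "?f T x \<le> length \<mu>" using x' by simp
    next
      fix r c assume "(r, Suc c) \<in> cells la'"
      then have "(r, Suc c) \<in> cells la" "(r, Suc c) \<noteq> ?x" using cells notin by auto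
      then show "?f T (r, c) \<le> ?f T (r, Suc c)"
        using ssytD(4)[OF T, of r c] by auto
    next
      fix r c assume "(Suc r, c) \<in> cells la'"
      then have 1: "(Suc r, c) \<in> cells la" "(Suc r, c) \<noteq> ?x" using cells notin by auto
      moreover have "(r, c) \<noteq> ?x" using 1 corner by auto
      ultimately show "?f T (r, c) < ?f T (Suc r, c)"
        using ssytD(5)[OF T, of r c] by auto
    next
      fix i assume i: "i \<in> {1..length \<mu>}"
      then have "{x \<in> cells la'. ?f T x = i} = {x \<in> cells la. T x = i}"
        using cells notin Tx by auto
      moreover have "i - 1 < length \<mu>" using i by auto
      ultimately show "card {x \<in> cells la'. ?f T x = i} = \<mu> ! (i - 1)"
        using ssytD(6)[OF T, of i] i by (simp add: nth_append)
    qed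
  qed
  have g: "?g T \<in> ssyt la (\<mu> @ [1])" if T: "T \<in> ssyt la' \<mu>" for T
    unfolding ssyt_def mem_Collect_eq
  proof (intro conjI allI ballI impI)
    show "?g T x = 0" if "x \<notin> cells la" for x
      using that cells ssytD(1)[OF T] by auto
  next
    fix x assume x: "x \<in> cells la"
    then show "1 \<le> ?g T x" "?g T x \<le> length (\<mu> @ [1])"
      using cells ssytD(2)[OF T, of x] ssyt_le_length[OF T, of x] by auto
  next
    fix r c assume rc: "(r, Suc c) \<in> cells la"
    then have "(r, c) \<noteq> ?x" using corner by auto
    then show "?g T (r, c) \<le> ?g T (r, Suc c)"
      using rc cells ssytD(4)[OF T, of r c] ssyt_le_length[OF T, of "(r, c)"] by auto
  next
    fix r c assume rc: "(Suc r, c) \<in> cells la"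
    then have "(r, c) \<noteq> ?x" using corner by auto
    then show "?g T (r, c) < ?g T (Suc r, c)"
      using rc cells ssytD(5)[OF T, of r c] ssyt_le_length[OF T, of "(r, c)"] by auto
  next
    fix i assume i: "i \<in> {1..length (\<mu> @ [1])}"
    show "card {x \<in> cells la. ?g T x = i} = (\<mu> @ [1]) ! (i - 1)"
    proof (cases "i = ?N")
      case True
      have "T x \<noteq> ?N" for x using ssyt_le_length[OF T, of x] by simp
      then have "{x \<in> cells la. ?g T x = i} = {?x}" using cells True by auto
      then show ?thesis using True by simp
    next
      case False
      then have "{x \<in> cells la. ?g T x = i} = {x \<in> cells la'. T x = i}"
        using cells notin by auto
      moreover have "1 \<le> i" "i \<le> length \<mu>" "i - 1 < length \<mu>" using i False by auto
      ultimately show ?thesis using ssytD(6)[OF T, of i] by (simp add: nth_append)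
    qed
  qed
  show "bij_betw ?f {T \<in> ssyt la (\<mu> @ [1]). T ?x = ?N} (ssyt la' \<mu>)"
  proof (rule bij_betw_byWitness[where f' = ?g])
    show "\<forall>T\<in>{T \<in> ssyt la (\<mu> @ [1]). T ?x = ?N}. ?g (?f T) = T" by auto
    show "\<forall>T\<in>ssyt la' \<mu>. ?f (?g T) = T"
    proof
      fix T assume "T \<in> ssyt la' \<mu>"
      then have "T ?x = 0" using ssytD(1) notin by blast
      then show "?f (?g T) = T" by auto
    qed
    show "?f ` {T \<in> ssyt la (\<mu> @ [1]). T ?x = ?N} \<subseteq> ssyt la' \<mu>" using f by auto
    show "?g ` ssyt la' \<mu> \<subseteq> {T \<in> ssyt la (\<mu> @ [1]). T ?x = ?N}" using g by auto
  qed
qed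

lemma cells_two_col:
  assumes "2 * c \<le> n"
  shows "cells (two_col n c) = {..<n - c} \<times> {0} \<union> {..<c} \<times> {1}"
  using assms by (auto simp: cells_def two_col_def nth_append split: if_splits)

lemma two_col_Suc: "2 * a \<le> n \<Longrightarrow> two_col (Suc n) a = two_col n a @ [1]"
  by (simp add: two_col_def Suc_diff_le replicate_append_same)

text \<open>The largest entry sits at the bottom of one of the two columns. If 2c = n + 1 the
  columns are equally long and the bottom of the first is not a corner.\<close>

lemma kostka_two_col_Suc:
  assumes "2 * c \<le> Suc n" "2 * a \<le> n"
  shows "kostka (two_col (Suc n) c) (two_col (Suc n) a) =
    (if 2 * c \<le> n then kostka (two_col n c) (two_col n a) else 0)
    + (if c = 0 then 0 else kostka (two_col n (c - 1)) (two_col n a))"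
proof -
  let ?la = "two_col (Suc n) c" and ?\<mu> = "two_col n a"
  let ?N = "Suc (length ?\<mu>)"
  let ?S = "\<lambda>x. {T \<in> ssyt ?la (?\<mu> @ [1]). T x = ?N}"
  have cells: "cells ?la = {..<Suc n - c} \<times> {0} \<union> {..<c} \<times> {1}" by (rule cells_two_col[OF assms(1)])
  have S0: "int (card (?S (n - c, 0))) = (if 2 * c \<le> n then kostka (two_col n c) ?\<mu> else 0)"
  proof (cases "2 * c \<le> n")
    case True
    have "card (?S (n - c, 0)) = card (ssyt (two_col n c) ?\<mu>)"
    proof (rule card_ssyt_corner)
      have "{..<Suc n - c} = insert (n - c) {..<n - c}" using True by auto
      then show "cells ?la = insert (n - c, 0) (cells (two_col n c))"
        unfolding cells cells_two_col[OF True] by auto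
      show "(n - c, 0) \<notin> cells (two_col n c)" "(n - c, Suc 0) \<notin> cells ?la" "(Suc (n - c), 0) \<notin> cells ?la"
        unfolding cells cells_two_col[OF True] using True by auto
    qed
    then show ?thesis using True by (simp add: kostka_def)
  next
    case False
    have "T (n - c, 0) \<noteq> ?N" if T: "T \<in> ssyt ?la (?\<mu> @ [1])" for T
    proof
      \<comment> \<open>The right neighbour in the second column would also have to carry the
        largest entry, which occurs only once.\<close>
      assume *: "T (n - c, 0) = ?N"
      have mem: "(n - c, 0) \<in> cells ?la" "(n - c, Suc 0) \<in> cells ?la"
        using False assms(1) by (auto simp: cells)
      then have "T (n - c, Suc 0) = ?N"
        using ssytD(4)[OF T mem(2)] ssytD(3)[OF T mem(2)] * by simp
      moreover obtain x where "{y \<in> cells ?la. T y = ?N} = {x}" using ssyt_largest_unique[OF T] .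
      ultimately have "(n - c, 0) = x" "(n - c, Suc 0) = x" using mem * by blast+
      then show False by auto
    qed
    then have "?S (n - c, 0) = {}" by blast
    then show ?thesis using False by (simp only: card.empty of_nat_0 if_False)
  qed
  have S1: "int (card (?S (c - 1, 1))) = (if c = 0 then 0 else kostka (two_col n (c - 1)) ?\<mu>)"
  proof (cases "c = 0")
    case True
    have notin: "(c - 1, 1) \<notin> cells ?la" unfolding cells using True by simp
    have "T (c - 1, 1) \<noteq> ?N" if "T \<in> ssyt ?la (?\<mu> @ [1])" for T
      unfolding ssytD(1)[OF that notin] by (rule Zero_not_Suc)
    then have "?S (c - 1, 1) = {}" by blast
    then show ?thesis using True by (simp only: card.empty of_nat_0 if_True simp_thms)
  next
    case False
    have "card (?S (c - 1, 1)) = card (ssyt (two_col n (c - 1)) ?\<mu>)"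
    proof (rule card_ssyt_corner)
      have le: "2 * (c - 1) \<le> n" using assms by simp
      have "{..<c} = insert (c - 1) {..<c - 1}" "n - (c - 1) = Suc n - c" using False assms by auto
      then show "cells ?la = insert (c - 1, 1) (cells (two_col n (c - 1)))"
        unfolding cells cells_two_col[OF le] by auto
      show "(c - 1, 1) \<notin> cells (two_col n (c - 1))" "(c - 1, Suc 1) \<notin> cells ?la" "(Suc (c - 1), 1) \<notin> cells ?la"
        unfolding cells cells_two_col[OF le] using False by auto
    qed
    then show ?thesis using False by (simp add: kostka_def)
  qed
  have "ssyt ?la (?\<mu> @ [1]) = ?S (n - c, 0) \<union> ?S (c - 1, 1)"
  proof -
    have "T (n - c, 0) = ?N \<or> T (c - 1, 1) = ?N" if T: "T \<in> ssyt ?la (?\<mu> @ [1])" for T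
    proof -
      obtain x where x: "{y \<in> cells ?la. T y = ?N} = {x}" using ssyt_largest_unique[OF T] .
      then have x1: "x \<in> cells ?la" "T x = ?N" by auto
      obtain r d where rd: "x = (r, d)" by fastforce
      have "(Suc r, d) \<notin> cells ?la"
      proof
        assume "(Suc r, d) \<in> cells ?la"
        from ssytD(5)[OF T this] ssytD(3)[OF T this] show False using x1 rd by simp
      qed
      then have "x = (n - c, 0) \<or> x = (c - 1, 1)" using x1(1) rd assms(1) by (auto simp: cells)
      then show ?thesis using x1 by auto
    qed
    then show ?thesis by blast
  qed
  moreover have "?S (n - c, 0) \<inter> ?S (c - 1, 1) = {}"
  proof -
    have False if T: "T \<in> ssyt ?la (?\<mu> @ [1])" "T (n - c, 0) = ?N" "T (c - 1, 1) = ?N" for T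
    proof -
      obtain x where x: "{y \<in> cells ?la. T y = ?N} = {x}" using ssyt_largest_unique[OF T(1)] .
      have "(n - c, 0) \<in> cells ?la" "(c - 1, 1) \<in> cells ?la"
        using T ssytD(1)[OF T(1)] by (metis nat.distinct(1))+
      then have "(n - c, 0) = x" "(c - 1, 1) = x" using x T by blast+
      then show False by auto
    qed
    then show ?thesis by blast
  qed
  ultimately have "card (ssyt ?la (?\<mu> @ [1])) = card (?S (n - c, 0)) + card (?S (c - 1, 1))"
    using card_Un_disjoint[of "?S (n - c, 0)" "?S (c - 1, 1)"]
      finite_subset[OF Collect_restrict finite_ssyt[of ?la "?\<mu> @ [1]"]] by metis
  then show ?thesis unfolding kostka_def[of ?la] two_col_Suc[OF assms(2)] using S0 S1 by (simp only: of_nat_add)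
qed

lemma is_partition_two_col: "is_partition (two_col n a)"
proof -
  have "sorted_wrt (\<ge>) (replicate k x)" for k and x :: nat by (induction k) auto
  then show ?thesis by (auto simp: is_partition_def two_col_def sorted_wrt_append)
qed

lemma sum_list_two_col: "2 * a \<le> n \<Longrightarrow> sum_list (two_col n a) = n"
  by (simp add: two_col_def sum_list_replicate)

lemma two_col_in_partitions: "2 * a \<le> n \<Longrightarrow> two_col n a \<in> partitions n"
  by (simp add: partitions_def is_partition_two_col sum_list_two_col)

lemma binomial_diff_Suc:
  "binomial_diff (Suc m) q a = binomial_diff m q a + (if q = 0 then 0 else binomial_diff m (q - 1) a)"
proof -
  consider "q < a" | "q = a" | k where "q = Suc (a + k)"
    by (metis add_Suc_right less_imp_Suc_add linorder_neqE_nat)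
  then show ?thesis by cases (auto simp: binomial_diff_def Suc_diff_le)
qed

text \<open>Induction on the number \<open>b\<close> of parts 1 in the content: both sides follow
  Pascal's rule, and for content 2^a only the shape 2^a itself contributes.\<close>

lemma kostka_two_col:
  assumes "2 * c \<le> n" "2 * a \<le> n"
  shows "kostka (two_col n c) (two_col n a) = int (binomial_diff (n - 2 * a) c a)
    - (if c = 0 then 0 else int (binomial_diff (n - 2 * a) (c - 1) a))"
proof -
  have "kostka (two_col (2 * a + b) c) (two_col (2 * a + b) a) = int (binomial_diff b c a)
    - (if c = 0 then 0 else int (binomial_diff b (c - 1) a))" if "2 * c \<le> 2 * a + b" for b
    using that
  proof (induction b arbitrary: c)
    case 0
    show ?case
    proof (cases "c = a")
      case True
      then show ?thesis by (simp add: kostka_self is_partition_two_col binomial_diff_def)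
    next
      case False
      then have less: "c < a" using 0 by simp
      have "\<not> dominated (two_col (2 * a) a) (two_col (2 * a) c)"
      proof
        \<comment> \<open>The first a rows of the two shapes have 2a and a + c cells, and c <
          a.\<close>
        assume "dominated (two_col (2 * a) a) (two_col (2 * a) c)"
        then have "sum_list (take a (two_col (2 * a) a)) \<le> sum_list (take a (two_col (2 * a) c))"
          by (simp add: dominated_def)
        then show False using less by (simp add: two_col_def sum_list_replicate min_def split: if_splits)
      qed
      then have "kostka (two_col (2 * a) c) (two_col (2 * a) a) = 0"
        using kostka_nonzero_dominated is_partition_two_col by blast
      moreover have "c - 1 < a" using less by simp
      ultimately show ?thesis using less by (simp add: binomial_diff_def)
    qed
  next
    case (Suc b)
    let ?f = "\<lambda>c. int (binomial_diff b c a) - (if c = 0 then 0 else int (binomial_diff b (c - 1) a))"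
    have "kostka (two_col (2 * a + Suc b) c) (two_col (2 * a + Suc b) a) =
      (if 2 * c \<le> 2 * a + b then ?f c else 0) + (if c = 0 then 0 else ?f (c - 1))"
    proof -
      have le: "2 * c \<le> Suc (2 * a + b)" "2 * a \<le> 2 * a + b" "2 * (c - 1) \<le> 2 * a + b"
        using Suc.prems by simp_all
      show ?thesis
        using Suc.IH[of c] unfolding add_Suc_right kostka_two_col_Suc[OF le(1,2)] Suc.IH[OF le(3)]
        by (cases "2 * c \<le> 2 * a + b") (simp_all only: if_True if_False)
    qed
    \<comment> \<open>Where 2c = 2a + b + 1 the recursion lacks a term; there b = 2(c - a) - 1, and
      the two binomials cancel by symmetry.\<close>
    moreover have "?f c = 0" if "\<not> 2 * c \<le> 2 * a + b"
    proof -
      have b: "b = 2 * (c - a) - 1" "a < c" using that Suc.prems by auto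
      then have "c - a \<le> b" "b - (c - a) = c - 1 - a" by arith+
      then have "b choose (c - a) = b choose (c - 1 - a)"
        using binomial_symmetric[of "c - a" b] by simp
      then show ?thesis using b by (simp add: binomial_diff_def)
    qed
    ultimately have "kostka (two_col (2 * a + Suc b) c) (two_col (2 * a + Suc b) a) = ?f c + (if c = 0 then 0 else ?f (c - 1))"
      by presburger
    then show ?case by (auto simp: binomial_diff_Suc)
  qed
  from this[of "n - 2 * a"] show ?thesis using assms by simp
qed

section \<open>Inverting the expansion\<close>

lemma part1_le_2_imp_two_col:
  assumes "\<nu> \<in> partitions n" "part1 \<nu> \<le> 2"
  shows "\<exists>a\<le>n div 2. \<nu> = two_col n a"
proof -
  have "\<exists>a b. \<nu> = replicate a 2 @ replicate b 1" if "is_partition \<nu>" "part1 \<nu> \<le> 2" for \<nu>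
    using that
  proof (induction \<nu>)
    case (Cons p \<nu>)
    then have p: "0 < p" "p \<le> 2" "\<forall>q\<in>set \<nu>. q \<le> p" by (auto simp: is_partition_def part1_def)
    then have "part1 \<nu> \<le> p" by (auto simp: part1_def)
    moreover have "is_partition \<nu>" using Cons.prems by (simp add: is_partition_def)
    ultimately obtain a b where ab: "\<nu> = replicate a 2 @ replicate b 1" using Cons.IH p by fastforce
    consider "p = 1" | "p = 2" using p by linarith
    then show ?case
    proof cases
      case 1
      then have "a = 0" using p ab by (cases a) auto
      then have "p # \<nu> = replicate 0 2 @ replicate (Suc b) 1" using ab 1 by simp
      then show ?thesis by blast
    next
      case 2
      then have "p # \<nu> = replicate (Suc a) 2 @ replicate b 1" using ab by simp
      then show ?thesis by blast
    qed
  qed simp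
  then obtain a b where ab: "\<nu> = replicate a 2 @ replicate b 1"
    using assms unfolding partitions_def by blast
  then have "n = 2 * a + b" using assms(1) by (auto simp: partitions_def sum_list_replicate)
  then show ?thesis using ab by (intro exI[of _ a]) (simp add: two_col_def)
qed

text \<open>The first partial sum is the first part; this confines the relevant rows of the matrices
  to at most two columns.\<close>

lemma part1_mono_dominated: "dominated \<mu> \<nu> \<Longrightarrow> part1 \<mu> \<le> part1 \<nu>"
  unfolding dominated_def part1_def by (drule spec[of _ 1]) (cases \<mu>; cases \<nu>; simp)

text \<open>The sum runs over all partitions to match the inverse matrix; a wider
  \<open>\<mu>\<close> is not dominated by \<open>\<nu>\<close>, so its Kostka number is 0.\<close>

lemma (in finite_31_free_poset) congH_JP_kostka:
  assumes \<nu>: "\<nu> \<in> partitions n" "part1 \<nu> \<le> 2"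
  shows "congH lt (JP lt \<nu>) (\<lambda>w. \<Sum>\<mu>\<in>partitions n. kostka \<nu> \<mu> * LTsum lt \<mu> w)"
proof -
  obtain c where c: "c \<le> n div 2" "\<nu> = two_col n c" using part1_le_2_imp_two_col[OF \<nu>] by blast
  have "(\<Sum>\<mu>\<in>partitions n. kostka \<nu> \<mu> * LTsum lt \<mu> w) =
      (\<Sum>a\<le>n div 2. (int (binomial_diff (n - 2 * a) c a)
        - (if c = 0 then 0 else int (binomial_diff (n - 2 * a) (c - 1) a))) * LTsum lt (two_col n a) w)" for w
  proof -
    have "(\<Sum>\<mu>\<in>partitions n. kostka \<nu> \<mu> * LTsum lt \<mu> w) =
        (\<Sum>\<mu>\<in>two_col n ` {..n div 2}. kostka \<nu> \<mu> * LTsum lt \<mu> w)"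
    proof (rule sum.mono_neutral_right)
      show "two_col n ` {..n div 2} \<subseteq> partitions n" using two_col_in_partitions by auto
      show "\<forall>\<mu>\<in>partitions n - two_col n ` {..n div 2}. kostka \<nu> \<mu> * LTsum lt \<mu> w = 0"
      proof
        fix \<mu> assume \<mu>: "\<mu> \<in> partitions n - two_col n ` {..n div 2}"
        then have "\<not> part1 \<mu> \<le> 2" using part1_le_2_imp_two_col[of \<mu> n] atMost_iff by blast
        then have "\<not> dominated \<mu> \<nu>" using part1_mono_dominated[of \<mu> \<nu>] \<nu>(2) by linarith
        moreover have "is_partition \<nu>" using \<nu>(1) by (simp add: partitions_def)
        ultimately have "kostka \<nu> \<mu> = 0" using kostka_nonzero_dominated by blast
        then show "kostka \<nu> \<mu> * LTsum lt \<mu> w = 0" by simp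
      qed
    qed (rule finite_partitions)
    also have "\<dots> = (\<Sum>a\<le>n div 2. kostka \<nu> (two_col n a) * LTsum lt (two_col n a) w)"
    proof -
      have "inj_on (two_col n) {..n div 2}"
      proof (rule inj_onI)
        fix a b assume "a \<in> {..n div 2}" "b \<in> {..n div 2}" and eq: "two_col n a = two_col n b"
        then have "2 * a \<le> n" "2 * b \<le> n" by auto
        from conj_part_two_col(2)[OF this(1)] conj_part_two_col(2)[OF this(2)] show "a = b"
          unfolding eq by simp
      qed
      then show ?thesis by (rule sum.reindex_cong) simp_all
    qed
    also have "\<dots> = (\<Sum>a\<le>n div 2. (int (binomial_diff (n - 2 * a) c a)
        - (if c = 0 then 0 else int (binomial_diff (n - 2 * a) (c - 1) a))) * LTsum lt (two_col n a) w)"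
      using c by (intro sum.cong) (simp_all add: kostka_two_col)
    finally show ?thesis .
  qed
  then show ?thesis using congH_JP_two_col[of c n] c by simp
qed

theorem mainTheorem11:
  fixes lt :: "'a::finite \<Rightarrow> 'a \<Rightarrow> bool" and la :: "nat list"
  assumes "strict_poset lt"
    and "free_3_1 lt"
    and "is_partition la"
    and "part1 la \<le> 2"
  shows "congH lt (mP lt la) (LTsum lt la)"
proof -
  interpret finite_31_free_poset lt using assms(1,2) by unfold_locales
  let ?n = "sum_list la" and ?M = "kostka_inv (sum_list la) la"
  have la: "la \<in> partitions ?n" using assms(3) by (simp add: partitions_def)
  have "congH lt (mP lt la) (\<lambda>w. \<Sum>\<nu>\<in>partitions ?n. ?M \<nu> * (\<Sum>\<mu>\<in>partitions ?n. kostka \<nu> \<mu> * LTsum lt \<mu> w))"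
    unfolding mP_def
  proof (intro congH_sum)
    fix \<nu> assume \<nu>: "\<nu> \<in> partitions ?n"
    show "congH lt (\<lambda>w. ?M \<nu> * JP lt \<nu> w) (\<lambda>w. ?M \<nu> * (\<Sum>\<mu>\<in>partitions ?n. kostka \<nu> \<mu> * LTsum lt \<mu> w))"
    \<comment> \<open>The expansion of \<open>JP\<close> is available for at most two columns; a
      nonzero coefficient makes \<open>\<nu>\<close> dominated by \<open>la\<close>, hence no
      wider.\<close>
    proof (cases "?M \<nu> = 0")
      case False
      then have "part1 \<nu> \<le> 2"
        using kostka_inv(2)[OF la la] part1_mono_dominated[of \<nu> la] assms(4) by fastforce
      then show ?thesis by (intro congH_scale congH_JP_kostka \<nu>)
    qed (simp add: congH_refl)
  qed
  moreover have "(\<Sum>\<nu>\<in>partitions ?n. ?M \<nu> * (\<Sum>\<mu>\<in>partitions ?n. kostka \<nu> \<mu> * LTsum lt \<mu> w)) = LTsum lt la w" for w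
  proof -
    have "(\<Sum>\<nu>\<in>partitions ?n. ?M \<nu> * (\<Sum>\<mu>\<in>partitions ?n. kostka \<nu> \<mu> * LTsum lt \<mu> w)) =
        (\<Sum>\<mu>\<in>partitions ?n. (\<Sum>\<nu>\<in>partitions ?n. ?M \<nu> * kostka \<nu> \<mu>) * LTsum lt \<mu> w)"
      unfolding sum_distrib_left sum_distrib_right mult.assoc by (rule sum.swap)
    also have "\<dots> = (\<Sum>\<mu>\<in>partitions ?n. if \<mu> = la then LTsum lt la w else 0)"
      by (rule sum.cong) (auto simp: kostka_inv(1)[OF la])
    also have "\<dots> = LTsum lt la w" using la finite_partitions by simp
    finally show ?thesis .
  qed
  ultimately show ?thesis by simp
qed

end
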